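(* Let $T$ be a nontrivial finite metric tree and let $T=A\cup B$ be an optimal split with $A\cap B=\{v\}$, $|A|=\lambda\ge b=|B|>0$, where $\lambda=\lambda(T)$. Assume that $\lambda>b$. Then there are three nontrivial metric subtrees $T_1,T_2,T_3$ of $T$, all containing $v$, such that $$T=T_1\cup T_2\cup T_3,\qquad T_i\cap T_j=\{v\}\ (i\ne j),\qquad |T_i|\le b\ (i=1,2,3).$$ Each pairwise union $T_i\cup T_j$ ($i\neq j$) has length at least $\lambda$ and has fewer leaves than $T$.
   Context: A finite metric tree is the metric realization of a finite combinatorial tree whose edges have positive lengths; it is nontrivial if it is not a single point. $|T|$ is the total edge length. A leaf of a metric tree $S$ is a point $x\in S$ such that $S\setminus\{x\}$ has exactly one component (for nontrivial $S$). A metric subtree of $T$ is a nonempty closed connected subset, itself regarded as a finite metric tree. A two-piece decomposition of $T$ is a pair of metric subtrees $T_1,T_2$ with $T=T_1\cup T_2$, $|T|=|T_1|+|T_2|$, and $T_1\cap T_2$ a single point. $\lambda(T)=\inf\max\{|T_1|,|T_2|\}$ over all two-piece decompositions; a two-piece decomposition attaining this infimum is an optimal split. *)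

theory Defs
  imports "HOL-Analysis.Analysis"
begin

definition combinatorial_tree :: "'v set \<Rightarrow> 'v set set \<Rightarrow> bool" where
  "combinatorial_tree V E \<longleftrightarrow>
     finite V \<and> V \<noteq> {} \<and>
     E \<subseteq> {{u, w} | u w. u \<in> V \<and> w \<in> V \<and> u \<noteq> w} \<and>
     (\<forall>u\<in>V. \<forall>w\<in>V. (u, w) \<in> {(x, y). {x, y} \<in> E}\<^sup>*) \<and>
     \<not> (\<exists>c. 3 \<le> length c \<and> distinct c \<and> successively (\<lambda>x y. {x, y} \<in> E) c \<and>
           {last c, hd c} \<in> E)"

definition geodesic_arc :: "'a::metric_space \<Rightarrow> 'a \<Rightarrow> real \<Rightarrow> 'a set \<Rightarrow> bool" where
  "geodesic_arc u w l S \<longleftrightarrow>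
     (\<exists>g. g 0 = u \<and> g l = w \<and> g ` {0..l} = S \<and>
          (\<forall>s\<in>{0..l}. \<forall>t\<in>{0..l}. dist (g s) (g t) = \<bar>s - t\<bar>))"

definition chain_length :: "'a::metric_space list \<Rightarrow> real" where
  "chain_length p = (\<Sum>i<length p - 1. dist (p ! i) (p ! Suc i))"

text \<open>
  The set \<open>T\<close> is (isometric to) the metric realization of the tree \<open>(V, E)\<close> with edge lengths
  \<open>len\<close>. The vertices are identified with the points of \<open>T\<close> that they become, and \<open>\<sigma> e\<close> is
  the closed edge of \<open>T\<close> that realizes \<open>e\<close>. The first four conditions on \<open>\<sigma>\<close> say that \<open>T\<close> is
  obtained from segments of the prescribed lengths by gluing them at common end vertices and
  nowhere else (in a tree the closed edges are isometrically embedded). The last condition says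
  that the metric of \<open>T\<close> is the path metric: by the triangle inequality no chain from \<open>x\<close> to
  \<open>y\<close> whose steps stay within single edges is shorter than \<open>dist x y\<close>, so \<open>dist x y\<close> is the
  least length of such a chain.
\<close>

definition metric_realization ::
  "'a::metric_space set \<Rightarrow> 'a set set \<Rightarrow> ('a set \<Rightarrow> real) \<Rightarrow> 'a set \<Rightarrow> bool" where
  "metric_realization V E len T \<longleftrightarrow>
     (\<exists>\<sigma>. (\<forall>u w. {u, w} \<in> E \<longrightarrow> geodesic_arc u w (len {u, w}) (\<sigma> {u, w})) \<and>
          T = V \<union> (\<Union>e\<in>E. \<sigma> e) \<and>
          (\<forall>e\<in>E. \<sigma> e \<inter> V = e) \<and>
          (\<forall>e\<in>E. \<forall>f\<in>E. e \<noteq> f \<longrightarrow> \<sigma> e \<inter> \<sigma> f = e \<inter> f) \<and>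
          (\<forall>x\<in>T. \<forall>y\<in>T. \<exists>p. p \<noteq> [] \<and> hd p = x \<and> last p = y \<and>
             successively (\<lambda>a b. \<exists>e\<in>E. a \<in> \<sigma> e \<and> b \<in> \<sigma> e) p \<and>
             chain_length p = dist x y))"

definition metric_tree_structure ::
  "'a::metric_space set \<Rightarrow> 'a set set \<Rightarrow> ('a set \<Rightarrow> real) \<Rightarrow> 'a set \<Rightarrow> bool" where
  "metric_tree_structure V E len T \<longleftrightarrow>
     combinatorial_tree V E \<and> (\<forall>e\<in>E. 0 < len e) \<and> metric_realization V E len T"

definition finite_metric_tree :: "'a::metric_space set \<Rightarrow> bool" where
  "finite_metric_tree T \<longleftrightarrow> (\<exists>V E len. metric_tree_structure V E len T)"

definition nontrivial_tree :: "'a set \<Rightarrow> bool" where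
  "nontrivial_tree T \<longleftrightarrow> \<not> (\<exists>x. T = {x})"

text \<open>
  The total edge length. It does not depend on the chosen structure (any two structures on \<open>T\<close>
  have a common subdivision), so for a finite metric tree the definite description is proper.
\<close>

definition tree_length :: "'a::metric_space set \<Rightarrow> real" where
  "tree_length T = (THE L. \<exists>V E len. metric_tree_structure V E len T \<and> L = (\<Sum>e\<in>E. len e))"

definition leaves :: "'a::topological_space set \<Rightarrow> 'a set" where
  "leaves S = {x \<in> S. \<exists>!C. C \<in> components (S - {x})}"

definition metric_subtree :: "'a::metric_space set \<Rightarrow> 'a set \<Rightarrow> bool" where
  "metric_subtree S T \<longleftrightarrow> S \<noteq> {} \<and> closedin (top_of_set T) S \<and> connected S"

definition two_piece_decomposition ::
  "'a::metric_space set \<Rightarrow> 'a set \<Rightarrow> 'a set \<Rightarrow> bool" where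
  "two_piece_decomposition T T1 T2 \<longleftrightarrow>
     metric_subtree T1 T \<and> metric_subtree T2 T \<and> T = T1 \<union> T2 \<and>
     tree_length T = tree_length T1 + tree_length T2 \<and> (\<exists>p. T1 \<inter> T2 = {p})"

definition split_length :: "'a::metric_space set \<Rightarrow> real" where
  "split_length T =
     Inf {max (tree_length T1) (tree_length T2) | T1 T2. two_piece_decomposition T T1 T2}"

definition optimal_split :: "'a::metric_space set \<Rightarrow> 'a set \<Rightarrow> 'a set \<Rightarrow> bool" where
  "optimal_split T T1 T2 \<longleftrightarrow>
     two_piece_decomposition T T1 T2 \<and>
     max (tree_length T1) (tree_length T2) = split_length T"

end

theory Submission
  imports Defs
begin

text \<open>
  Write \<open>\<bar>X\<bar>\<close> for the length of a tree \<open>X\<close>. Whenever \<open>T\<close> is the union of two closed sets \<open>C\<close> and \<open>D\<close> that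
  meet in one point, both are trees and \<open>\<bar>T\<bar> = \<bar>C\<bar> + \<bar>D\<bar>\<close> (\<open>cut_at_point\<close>). So every such pair is a
  two-piece decomposition, and \<open>max \<bar>C\<bar> \<bar>D\<bar> \<ge> \<lambda>\<close> (\<open>split_length_le\<close>).

  Take an edge of \<open>A\<close> at \<open>v\<close>. Deleting its interior separates \<open>A\<close> into a part \<open>P\<close> containing \<open>v\<close> and a
  part containing its other end. If \<open>P\<close> were only \<open>{v}\<close>, the cut could be moved along the edge by a
  small \<open>t > 0\<close>, and the pieces of lengths \<open>\<lambda> - t\<close> and \<open>b + t\<close> would beat the optimal split. Hence
  \<open>A = P \<union> R\<close> with \<open>P\<close>, \<open>R\<close> nontrivial and \<open>P \<inter> R = {v}\<close>, where \<open>R\<close> is the rest of \<open>A\<close> together with \<open>v\<close>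
  (\<open>optimal_split_longer_piece_branches\<close>). The three subtrees are \<open>P\<close>, \<open>R\<close> and \<open>B\<close>. Cutting \<open>T\<close> into
  \<open>P\<close> and \<open>R \<union> B\<close> gives pieces whose maximum is at least \<open>\<lambda>\<close>; as \<open>\<bar>P\<bar> < \<bar>A\<bar> = \<lambda>\<close>, this means
  \<open>\<bar>R \<union> B\<bar> \<ge> \<lambda>\<close>, and since the two lengths add up to \<open>\<lambda> + b\<close>, \<open>\<bar>P\<bar> \<le> b\<close>. The same holds with \<open>P\<close> and \<open>R\<close>
  exchanged.

  A union of two of the three has fewer leaves because \<open>v\<close> is not one of its leaves, its leaves are
  therefore leaves of \<open>T\<close>, and a point of the third subtree farthest from \<open>v\<close> is a further leaf of
  \<open>T\<close> (\<open>card_leaves_two_of_three_less\<close>).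

  What remains is that the length does not depend on the chosen combinatorial structure. It is
  recovered from the metric alone: up to an error that stays bounded as \<open>r\<close> tends to \<open>0\<close>, the largest
  \<open>r\<close>-separated subset of \<open>T\<close> has \<open>\<bar>T\<bar> / r\<close> points (\<open>card_separated_le\<close>, \<open>ex_large_separated\<close>).
\<close>

section \<open>Bridges in combinatorial trees\<close>

definition adj :: "'v set set \<Rightarrow> ('v \<times> 'v) set" where
  "adj E = {(x, y). {x, y} \<in> E}"

lemma adj_iff: "(x, y) \<in> adj E \<longleftrightarrow> {x, y} \<in> E"
  by (simp add: adj_def)

lemma rtrancl_map_rtrancl:
  assumes "(x, y) \<in> R\<^sup>*" and "\<And>a b. (a, b) \<in> R \<Longrightarrow> (f a, f b) \<in> S\<^sup>*"
  shows "(f x, f y) \<in> S\<^sup>*"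
  using assms(1)
proof induction
  case (step y z)
  then show ?case using assms(2) by (meson rtrancl_trans)
qed simp

lemma adj_rtrancl_imp_simple_path:
  assumes "(u, w) \<in> (adj F)\<^sup>*"
  shows "\<exists>c. c \<noteq> [] \<and> hd c = u \<and> last c = w \<and> distinct c \<and> successively (\<lambda>x y. {x, y} \<in> F) c"
  using assms
proof (induction rule: converse_rtrancl_induct)
  case base
  show ?case by (rule exI[of _ "[w]"]) simp
next
  case (step u u')
  then obtain c where c: "c \<noteq> []" "hd c = u'" "last c = w" "distinct c"
      "successively (\<lambda>x y. {x, y} \<in> F) c"
    by blast
  show ?case
  proof (cases "u \<in> set c")
    case True
    then obtain ys zs where "c = ys @ u # zs" by (meson split_list)
    with c show ?thesis
      by (intro exI[of _ "u # zs"]) (auto simp: successively_append_iff)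
  next
    case False
    with c step(1) show ?thesis
      by (intro exI[of _ "u # c"]) (cases c; auto simp: adj_iff)
  qed
qed

lemma successively_imp_rtrancl:
  assumes "c \<noteq> []" and "successively (\<lambda>x y. (x, y) \<in> R) c"
  shows "(hd c, last c) \<in> R\<^sup>*"
  using assms
proof (induction c rule: induct_list012)
  case (3 x y zs)
  then show ?case by (auto intro: converse_rtrancl_into_rtrancl)
qed auto

text \<open>
  Closing a simple path that avoids the edge \<open>{u, w}\<close> by this edge gives a cycle, and deleting an
  edge of a cycle leaves such a path. Maps of graphs carry paths to paths but not cycles to cycles,
  so the condition on bridges is the one to use for subdivisions.
\<close>

lemma acyclic_iff_bridges:
  assumes "E \<subseteq> {{u, w} | u w. u \<in> V \<and> w \<in> V \<and> u \<noteq> w}"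
  shows "\<not> (\<exists>c. 3 \<le> length c \<and> distinct c \<and> successively (\<lambda>x y. {x, y} \<in> E) c \<and>
                {last c, hd c} \<in> E) \<longleftrightarrow>
         (\<forall>u w. {u, w} \<in> E \<longrightarrow> (u, w) \<notin> (adj (E - {{u, w}}))\<^sup>*)"
    (is "\<not> ?cycle \<longleftrightarrow> ?bridges")
proof
  assume nc: "\<not> ?cycle"
  show ?bridges
  proof (intro allI impI notI)
    fix u w assume e: "{u, w} \<in> E" and path: "(u, w) \<in> (adj (E - {{u, w}}))\<^sup>*"
    have "u \<noteq> w" using e assms by (auto simp: doubleton_eq_iff)
    obtain c where c: "c \<noteq> []" "hd c = u" "last c = w" "distinct c"
      "successively (\<lambda>x y. {x, y} \<in> E - {{u, w}}) c"
      using adj_rtrancl_imp_simple_path[OF path] by blast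
    have "3 \<le> length c"
    proof (rule ccontr)
      assume "\<not> 3 \<le> length c"
      then consider x where "c = [x]" | x y where "c = [x, y]"
        using c(1) by (cases c rule: remdups_adj.cases) (auto simp: Suc_le_eq)
      then show False using c \<open>u \<noteq> w\<close> by cases auto
    qed
    moreover have "successively (\<lambda>x y. {x, y} \<in> E) c"
      using c(5) by (rule successively_mono) auto
    ultimately show False using nc c e by (auto simp: insert_commute)
  qed
next
  assume br: ?bridges
  show "\<not> ?cycle"
  proof
    assume ?cycle
    then obtain c where c: "3 \<le> length c" "distinct c" "successively (\<lambda>x y. {x, y} \<in> E) c"
      "{last c, hd c} \<in> E" by blast
    have ne: "c \<noteq> []" using c(1) by auto
    have "successively (\<lambda>x y. (x, y) \<in> adj (E - {{hd c, last c}})) c"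
      unfolding successively_conv_nth
    proof (intro allI impI)
      fix i assume i: "Suc i < length c"
      have "{c ! i, c ! Suc i} \<in> E" using c(3) i by (auto simp: successively_conv_nth)
      moreover have "{c ! i, c ! Suc i} \<noteq> {c ! 0, c ! (length c - 1)}"
        using c(1,2) i ne by (auto simp: doubleton_eq_iff nth_eq_iff_index_eq)
      ultimately show "(c ! i, c ! Suc i) \<in> adj (E - {{hd c, last c}})"
        using ne by (simp add: adj_iff hd_conv_nth last_conv_nth)
    qed
    then have "(hd c, last c) \<in> (adj (E - {{hd c, last c}}))\<^sup>*"
      using ne successively_imp_rtrancl by blast
    then show False using br c(4) by (metis insert_commute)
  qed
qed

lemma combinatorial_tree_iff_bridges:
  "combinatorial_tree V E \<longleftrightarrow>
     finite V \<and> V \<noteq> {} \<and> E \<subseteq> {{u, w} | u w. u \<in> V \<and> w \<in> V \<and> u \<noteq> w} \<and>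
     (\<forall>u\<in>V. \<forall>w\<in>V. (u, w) \<in> (adj E)\<^sup>*) \<and>
     (\<forall>u w. {u, w} \<in> E \<longrightarrow> (u, w) \<notin> (adj (E - {{u, w}}))\<^sup>*)"
  unfolding combinatorial_tree_def adj_def[of E, symmetric]
  using acyclic_iff_bridges[of E V] by blast

text \<open>
  Contracting \<open>{u, m}\<close> maps the subdivided graph to the old one, and contracting \<open>{m, w}\<close> does
  so as well. Either map carries a path that avoids an edge to a path that avoids its image, so
  bridges remain bridges.
\<close>

lemma combinatorial_tree_subdivide:
  assumes "combinatorial_tree V E" and e: "{u, w} \<in> E" and m: "m \<notin> V"
  shows "combinatorial_tree (insert m V) (insert {u, m} (insert {m, w} (E - {{u, w}})))"
    (is "combinatorial_tree ?V ?E")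
proof -
  have fin: "finite V" and sub: "E \<subseteq> {{u, w} | u w. u \<in> V \<and> w \<in> V \<and> u \<noteq> w}"
    and con: "\<And>x y. x \<in> V \<Longrightarrow> y \<in> V \<Longrightarrow> (x, y) \<in> (adj E)\<^sup>*"
    and br: "\<And>x y. {x, y} \<in> E \<Longrightarrow> (x, y) \<notin> (adj (E - {{x, y}}))\<^sup>*"
    using assms(1) by (auto simp: combinatorial_tree_iff_bridges)
  have uw: "u \<in> V" "w \<in> V" "u \<noteq> w" "u \<noteq> m" "w \<noteq> m"
    using e sub m by (auto simp: doubleton_eq_iff)
  have inV: "x \<in> V \<and> y \<in> V" if "{x, y} \<in> E" for x y
    using that sub by (auto simp: doubleton_eq_iff)
  have swap: "(y, x) \<in> (adj F)\<^sup>*" if "(x, y) \<in> (adj F)\<^sup>*" for F :: "'a set set" and x y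
  proof -
    have "sym (adj F)" by (auto simp: sym_def adj_iff insert_commute)
    then show ?thesis using that by (meson sym_rtrancl symD)
  qed
  have um: "(u, m) \<in> (adj ?E)\<^sup>*" and mw: "(m, w) \<in> (adj ?E)\<^sup>*"
    by (auto simp: adj_iff)
  have old: "(x, y) \<in> (adj ?E)\<^sup>*" if "x \<in> V" "y \<in> V" for x y
  proof -
    have "(id x, id y) \<in> (adj ?E)\<^sup>*"
      using con[OF that]
    proof (rule rtrancl_map_rtrancl)
      fix a b assume ab: "(a, b) \<in> adj E"
      have uw': "(u, w) \<in> (adj ?E)\<^sup>*" using um mw by simp
      show "(id a, id b) \<in> (adj ?E)\<^sup>*"
      proof (cases "{a, b} = {u, w}")
        case True
        then show ?thesis using uw' swap[OF uw'] by (auto simp: doubleton_eq_iff)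
      next
        case False
        then show ?thesis using ab by (intro r_into_rtrancl) (auto simp: adj_iff)
      qed
    qed
    then show ?thesis by simp
  qed
  have con': "(x, y) \<in> (adj ?E)\<^sup>*" if "x \<in> ?V" "y \<in> ?V" for x y
  proof -
    have to_u: "(z, u) \<in> (adj ?E)\<^sup>*" if "z \<in> ?V" for z
      using that old[of z u] uw swap[OF um] by auto
    have "(u, y) \<in> (adj ?E)\<^sup>*" using swap[OF to_u[OF that(2)]] .
    then show ?thesis using to_u[OF that(1)] by simp
  qed
  have br': "(x, y) \<notin> (adj (?E - {{x, y}}))\<^sup>*" if xy: "{x, y} \<in> ?E" for x y
  proof
    assume path: "(x, y) \<in> (adj (?E - {{x, y}}))\<^sup>*"
    define f where "f = (\<lambda>z. if z = m then u else z)"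
    define h where "h = (\<lambda>z. if z = m then w else z)"
    consider "{x, y} = {u, m}" | "{x, y} = {m, w}" | "{x, y} \<in> E" "{x, y} \<noteq> {u, w}"
      using xy by auto
    then show False
    proof cases
      case 1
      have "(h x, h y) \<in> (adj (E - {{u, w}}))\<^sup>*"
        using path
      proof (rule rtrancl_map_rtrancl)
        fix a b assume "(a, b) \<in> adj (?E - {{x, y}})"
        then have "{a, b} = {m, w} \<or> {a, b} \<in> E - {{u, w}}" using 1 by (auto simp: adj_iff)
        then show "(h a, h b) \<in> (adj (E - {{u, w}}))\<^sup>*"
        proof
          assume "{a, b} = {m, w}"
          then have "h a = h b" by (auto simp: doubleton_eq_iff h_def)
          then show ?thesis by simp
        next
          assume ab: "{a, b} \<in> E - {{u, w}}"
          then have "h a = a" "h b = b" using inV m by (auto simp: h_def)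
          then show ?thesis using ab by (intro r_into_rtrancl) (simp add: adj_iff)
        qed
      qed
      then have "(u, w) \<in> (adj (E - {{u, w}}))\<^sup>*"
        using 1 uw swap by (metis doubleton_eq_iff h_def)
      then show False using br[OF e] by simp
    next
      case 2
      have "(f x, f y) \<in> (adj (E - {{u, w}}))\<^sup>*"
        using path
      proof (rule rtrancl_map_rtrancl)
        fix a b assume "(a, b) \<in> adj (?E - {{x, y}})"
        then have "{a, b} = {u, m} \<or> {a, b} \<in> E - {{u, w}}" using 2 by (auto simp: adj_iff)
        then show "(f a, f b) \<in> (adj (E - {{u, w}}))\<^sup>*"
        proof
          assume "{a, b} = {u, m}"
          then have "f a = f b" by (auto simp: doubleton_eq_iff f_def)
          then show ?thesis by simp
        next
          assume ab: "{a, b} \<in> E - {{u, w}}"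
          then have "f a = a" "f b = b" using inV m by (auto simp: f_def)
          then show ?thesis using ab by (intro r_into_rtrancl) (simp add: adj_iff)
        qed
      qed
      then have "(u, w) \<in> (adj (E - {{u, w}}))\<^sup>*"
        using 2 uw swap by (metis doubleton_eq_iff f_def)
      then show False using br[OF e] by simp
    next
      case 3
      have "(f x, f y) \<in> (adj (E - {{x, y}}))\<^sup>*"
        using path
      proof (rule rtrancl_map_rtrancl)
        fix a b assume "(a, b) \<in> adj (?E - {{x, y}})"
        then consider "{a, b} = {u, m}" | "{a, b} = {m, w}" | "{a, b} \<in> E - {{x, y}}"
          by (auto simp: adj_iff)
        then show "(f a, f b) \<in> (adj (E - {{x, y}}))\<^sup>*"
        proof cases
          case 1
          then have "f a = f b" by (auto simp: doubleton_eq_iff f_def)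
          then show ?thesis by simp
        next
          case 2
          then have "{f a, f b} = {u, w}" using uw m by (auto simp: doubleton_eq_iff f_def)
          then have "(f a, f b) \<in> adj (E - {{x, y}})" using e 3 by (simp add: adj_iff)
          then show ?thesis by blast
        next
          case 3
          then have "f a = a" "f b = b" using inV m by (auto simp: f_def)
          then show ?thesis using 3 by (intro r_into_rtrancl) (simp add: adj_iff)
        qed
      qed
      moreover have "f x = x" "f y = y" using inV[OF 3(1)] m by (auto simp: f_def)
      ultimately show False using br[OF 3(1)] by simp
    qed
  qed
  have "?E \<subseteq> {{u, w} | u w. u \<in> ?V \<and> w \<in> ?V \<and> u \<noteq> w}"
    using sub uw m by (auto 0 4)
  then show ?thesis
    unfolding combinatorial_tree_iff_bridges using fin con' br' by auto
qed

section \<open>Chains and geodesic arcs\<close>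

text \<open>
  Chains with a given relation between consecutive points, carrying their length as an argument, so
  that statements about chains are proved by rule induction.
\<close>

inductive broken_path :: "('a::metric_space \<Rightarrow> 'a \<Rightarrow> bool) \<Rightarrow> 'a \<Rightarrow> 'a \<Rightarrow> real \<Rightarrow> bool"
  for R where
  refl: "broken_path R x x 0"
| step: "R x y \<Longrightarrow> broken_path R y z L \<Longrightarrow> broken_path R x z (dist x y + L)"

lemma chain_length_singleton [simp]: "chain_length [x] = 0"
  by (simp add: chain_length_def)

lemma chain_length_Cons_Cons [simp]:
  "chain_length (x # y # p) = dist x y + chain_length (y # p)"
  by (simp add: chain_length_def sum.lessThan_Suc_shift del: sum.lessThan_Suc)

lemma broken_path_single: "R x y \<Longrightarrow> broken_path R x y (dist x y)"
  using broken_path.step[of R x y y 0] broken_path.refl[of R y] by simp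

lemma broken_path_iff_chain:
  "broken_path R x y L \<longleftrightarrow>
     (\<exists>p. p \<noteq> [] \<and> hd p = x \<and> last p = y \<and> successively R p \<and> chain_length p = L)"
proof
  assume "broken_path R x y L"
  then show "\<exists>p. p \<noteq> [] \<and> hd p = x \<and> last p = y \<and> successively R p \<and> chain_length p = L"
  proof induction
    case (refl x)
    show ?case by (rule exI[of _ "[x]"]) simp
  next
    case (step x y z L)
    then obtain p where "p \<noteq> []" "hd p = y" "last p = z" "successively R p" "chain_length p = L"
      by blast
    with step(1) show ?case by (intro exI[of _ "x # p"]) (cases p; auto)
  qed
next
  have "p \<noteq> [] \<Longrightarrow> successively R p \<Longrightarrow> broken_path R (hd p) (last p) (chain_length p)" for p
    by (induction p rule: induct_list012) (auto intro: broken_path.intros broken_path_single)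
  then show "\<exists>p. p \<noteq> [] \<and> hd p = x \<and> last p = y \<and> successively R p \<and> chain_length p = L \<Longrightarrow>
             broken_path R x y L"
    by blast
qed

lemma broken_path_trans:
  assumes "broken_path R x y K" and "broken_path R y z L"
  shows "broken_path R x z (K + L)"
  using assms by induction (auto simp: add.assoc intro: broken_path.intros)

lemma dist_le_broken_path: "broken_path R x y L \<Longrightarrow> dist x y \<le> L"
proof (induction rule: broken_path.induct)
  case (step x y z L)
  then show ?case using dist_triangle[of x z y] by linarith
qed simp

definition isometric_on_segment :: "(real \<Rightarrow> 'a::metric_space) \<Rightarrow> real \<Rightarrow> bool" where
  "isometric_on_segment g l \<longleftrightarrow> (\<forall>s\<in>{0..l}. \<forall>t\<in>{0..l}. dist (g s) (g t) = \<bar>s - t\<bar>)"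

lemma isometric_on_segmentD:
  "isometric_on_segment g l \<Longrightarrow> 0 \<le> s \<Longrightarrow> s \<le> l \<Longrightarrow> 0 \<le> t \<Longrightarrow> t \<le> l \<Longrightarrow> dist (g s) (g t) = \<bar>s - t\<bar>"
  by (simp add: isometric_on_segment_def)

lemma isometric_on_segment_continuous:
  "isometric_on_segment g l \<Longrightarrow> continuous_on {0..l} g"
  unfolding isometric_on_segment_def continuous_on_iff by (metis dist_real_def)

lemma isometric_on_segment_inj: "isometric_on_segment g l \<Longrightarrow> inj_on g {0..l}"
  unfolding isometric_on_segment_def inj_on_def by fastforce

lemma isometric_on_segment_image:
  assumes "isometric_on_segment g l" and "0 \<le> s" and "t \<le> l"
  shows "connected (g ` {s..t})" and "compact (g ` {s..t})"
proof -
  have "continuous_on {s..t} g"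
    using isometric_on_segment_continuous[OF assms(1)] by (rule continuous_on_subset) (use assms in auto)
  then show "connected (g ` {s..t})" "compact (g ` {s..t})"
    by (auto intro: connected_continuous_image compact_continuous_image)
qed

lemma isometric_on_segment_image_Int:
  assumes "isometric_on_segment g l" and "0 \<le> t" and "t \<le> l"
  shows "g ` {0..t} \<inter> g ` {t..l} = {g t}"
proof -
  have "g ` {0..t} \<inter> g ` {t..l} = g ` ({0..t} \<inter> {t..l})"
    using isometric_on_segment_inj[OF assms(1)] by (rule inj_on_image_Int[symmetric]) (use assms in auto)
  also have "{0..t} \<inter> {t..l} = {t}" using assms by auto
  finally show ?thesis by simp
qed

lemma geodesic_arc_iff:
  "geodesic_arc u w l S \<longleftrightarrow> (\<exists>g. g 0 = u \<and> g l = w \<and> g ` {0..l} = S \<and> isometric_on_segment g l)"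
  by (simp add: geodesic_arc_def isometric_on_segment_def)

lemma geodesic_arc_commute:
  assumes "geodesic_arc u w l S"
  shows "geodesic_arc w u l S"
proof -
  obtain g where g: "g 0 = u" "g l = w" "g ` {0..l} = S" "isometric_on_segment g l"
    using assms by (auto simp: geodesic_arc_iff)
  have "(\<lambda>s. g (l - s)) ` {0..l} = g ` (\<lambda>s. l - s) ` {0..l}"
    by (simp only: image_image)
  also have "(\<lambda>s. l - s) ` {0..l} = {0..l}"
    by simp
  finally have "(\<lambda>s. g (l - s)) ` {0..l} = S" using g by simp
  moreover have "isometric_on_segment (\<lambda>s. g (l - s)) l"
    using g(4) by (auto simp: isometric_on_segment_def)
  ultimately show ?thesis
    unfolding geodesic_arc_iff using g by (intro exI[of _ "\<lambda>s. g (l - s)"]) simp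
qed

lemma geodesic_arc_subsegment:
  assumes "isometric_on_segment g l" and "0 \<le> s" and "s \<le> t" and "t \<le> l"
  shows "geodesic_arc (g s) (g t) (t - s) (g ` {s..t})"
proof -
  have "(\<lambda>r. g (s + r)) ` {0..t - s} = g ` (\<lambda>r. s + r) ` {0..t - s}"
    by (simp only: image_image)
  also have "(\<lambda>r. s + r) ` {0..t - s} = {s..t}"
    using image_add_atLeastAtMost[of s 0 "t - s"] by simp
  finally have "(\<lambda>r. g (s + r)) ` {0..t - s} = g ` {s..t}" .
  moreover have "isometric_on_segment (\<lambda>r. g (s + r)) (t - s)"
    using assms by (auto simp: isometric_on_segment_def)
  ultimately show ?thesis
    unfolding geodesic_arc_iff by (intro exI[of _ "\<lambda>r. g (s + r)"]) simp
qed


section \<open>Metric realizations\<close>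

text \<open>
  A metric tree with a fixed structure, including the map \<open>\<sigma>\<close> from edges to arcs that
  \<open>metric_realization\<close> only asserts to exist.
\<close>

locale realized_tree =
  fixes V :: "'a::metric_space set" and E :: "'a set set" and len :: "'a set \<Rightarrow> real"
    and \<sigma> :: "'a set \<Rightarrow> 'a set" and T :: "'a set"
  assumes combinatorial: "combinatorial_tree V E"
    and len_pos: "e \<in> E \<Longrightarrow> 0 < len e"
    and arc: "{u, w} \<in> E \<Longrightarrow> geodesic_arc u w (len {u, w}) (\<sigma> {u, w})"
    and T_eq: "T = V \<union> (\<Union>e\<in>E. \<sigma> e)"
    and edge_Int_vertices: "e \<in> E \<Longrightarrow> \<sigma> e \<inter> V = e"
    and edge_Int_edge: "e \<in> E \<Longrightarrow> f \<in> E \<Longrightarrow> e \<noteq> f \<Longrightarrow> \<sigma> e \<inter> \<sigma> f = e \<inter> f"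
    and path_metric: "x \<in> T \<Longrightarrow> y \<in> T \<Longrightarrow>
          broken_path (\<lambda>a b. \<exists>e\<in>E. a \<in> \<sigma> e \<and> b \<in> \<sigma> e) x y (dist x y)"

lemma metric_tree_structure_iff_realized_tree:
  "metric_tree_structure V E len T \<longleftrightarrow> (\<exists>\<sigma>. realized_tree V E len \<sigma> T)"
  unfolding metric_tree_structure_def metric_realization_def realized_tree_def
    broken_path_iff_chain
  by (simp add: Ball_def)

context realized_tree
begin

abbreviation same_edge :: "'a \<Rightarrow> 'a \<Rightarrow> bool" where
  "same_edge a b \<equiv> \<exists>e\<in>E. a \<in> \<sigma> e \<and> b \<in> \<sigma> e"

lemma finite_V: "finite V" and V_nonempty: "V \<noteq> {}"
  and E_doubletons: "E \<subseteq> {{u, w} | u w. u \<in> V \<and> w \<in> V \<and> u \<noteq> w}"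
  and vertices_connected: "u \<in> V \<Longrightarrow> w \<in> V \<Longrightarrow> (u, w) \<in> (adj E)\<^sup>*"
  and bridge: "{u, w} \<in> E \<Longrightarrow> (u, w) \<notin> (adj (E - {{u, w}}))\<^sup>*"
  using combinatorial by (auto simp: combinatorial_tree_iff_bridges)

lemma finite_E: "finite E"
  by (rule finite_subset[of _ "Pow V"]) (use E_doubletons finite_V in auto)

lemma edge_ends: "{u, w} \<in> E \<Longrightarrow> u \<in> V \<and> w \<in> V \<and> u \<noteq> w"
  using E_doubletons by (auto simp: doubleton_eq_iff)

lemma edge_parametrization:
  assumes "{u, w} \<in> E"
  obtains g where "g 0 = u" "g (len {u, w}) = w" "g ` {0..len {u, w}} = \<sigma> {u, w}"
    "isometric_on_segment g (len {u, w})"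
  using arc[OF assms] by (auto simp: geodesic_arc_iff)

lemma edge_cases:
  assumes "e \<in> E"
  obtains u w where "e = {u, w}" "{u, w} \<in> E" "u \<in> V" "w \<in> V" "u \<noteq> w"
  using assms E_doubletons by blast

lemma edge_connected: "e \<in> E \<Longrightarrow> connected (\<sigma> e)"
  and edge_compact: "e \<in> E \<Longrightarrow> compact (\<sigma> e)"
proof -
  assume "e \<in> E"
  then obtain u w where e: "e = {u, w}" "{u, w} \<in> E" by (rule edge_cases)
  then obtain g where g: "g ` {0..len e} = \<sigma> e" "isometric_on_segment g (len e)"
    using edge_parametrization by metis
  show "connected (\<sigma> e)" "compact (\<sigma> e)"
    using isometric_on_segment_image[OF g(2) order_refl order_refl] g(1) by auto
qed

lemma T_compact: "compact T"
  unfolding T_eq using finite_V finite_E edge_compact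
  by (intro compact_Un compact_UN) (auto intro: finite_imp_compact)

lemma edge_subset_T: "e \<in> E \<Longrightarrow> \<sigma> e \<subseteq> T"
  using T_eq by auto

lemma ends_in_edge: "e \<in> E \<Longrightarrow> e \<subseteq> \<sigma> e"
  using edge_Int_vertices by auto

lemma T_connected: "connected T"
proof -
  have "connected_component T x y" if "broken_path same_edge x y L" "y \<in> T" for x y L
    using that
  proof (induction rule: broken_path.induct)
    case (step x y z L)
    then obtain e where e: "e \<in> E" "x \<in> \<sigma> e" "y \<in> \<sigma> e" by blast
    then have "connected_component T x y"
      using edge_connected edge_subset_T by (auto simp: connected_component_def)
    then show ?case using step by (metis connected_component_trans)
  qed simp
  then show ?thesis
    unfolding connected_iff_connected_component by (blast intro: path_metric)
qed

lemma edgeless: "E = {} \<Longrightarrow> \<exists>x. T = {x}"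
proof -
  assume E: "E = {}"
  obtain x where x: "x \<in> V" using V_nonempty by blast
  have "y = x" if "y \<in> V" for y
    using vertices_connected[OF x that] E by (auto simp: adj_def elim: rtranclE)
  then show ?thesis using x T_eq E by auto
qed

lemma edgeless_iff: "E = {} \<longleftrightarrow> (\<exists>x. T = {x})"
proof
  assume "\<exists>x. T = {x}"
  then obtain x where x: "T = {x}" by blast
  have "e \<notin> E" for e
  proof
    assume "e \<in> E"
    then obtain u w where uw: "u \<in> V" "w \<in> V" "u \<noteq> w" by (rule edge_cases)
    moreover from this have "u \<in> T" "w \<in> T" using T_eq by auto
    ultimately show False using x by simp
  qed
  then show "E = {}" by auto
qed (rule edgeless)

lemma length_pos_iff: "0 < sum len E \<longleftrightarrow> \<not> (\<exists>x. T = {x})"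
proof (cases "E = {}")
  case False
  then show ?thesis using edgeless_iff sum_pos[OF finite_E False len_pos] by simp
qed (use edgeless_iff in auto)

text \<open>
  A chain whose steps stay in single edges can only leave an edge through one of its ends,
  because distinct edges meet only there.
\<close>

lemma broken_path_leaves_edge_through_end:
  assumes "broken_path same_edge x y L" and "e \<in> E" and "x \<in> \<sigma> e" and "y \<notin> \<sigma> e"
  shows "\<exists>a\<in>e. dist x a \<le> L"
  using assms(1,3,4)
proof (induction rule: broken_path.induct)
  case (step x y z L)
  have "0 \<le> L" using dist_le_broken_path[OF step(2)] zero_le_dist[of y z] by linarith
  show ?case
  proof (cases "y \<in> \<sigma> e")
    case True
    then obtain a where "a \<in> e" "dist y a \<le> L" using step by blast
    then show ?thesis using dist_triangle[of x a y] by (intro bexI[of _ a]) auto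
  next
    case False
    obtain f where "f \<in> E" "x \<in> \<sigma> f" "y \<in> \<sigma> f" using step(1) by blast
    then have "x \<in> e" using False edge_Int_edge[of e f] step.prems assms(2) by auto
    then show ?thesis using \<open>0 \<le> L\<close> by (intro bexI[of _ x]) auto
  qed
qed simp

end

section \<open>The total edge length is intrinsic\<close>

definition separated :: "real \<Rightarrow> 'a::metric_space set \<Rightarrow> bool" where
  "separated r F \<longleftrightarrow> (\<forall>x\<in>F. \<forall>y\<in>F. x \<noteq> y \<longrightarrow> r \<le> dist x y)"

text \<open>
  Divide the segment into half-open intervals of length \<open>r\<close>; each contains at most one point.
\<close>

lemma card_separated_segment_le:
  assumes g: "isometric_on_segment g l" and "0 \<le> l" and "0 < r"
    and F: "F \<subseteq> g ` {0..l}" "separated r F"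
  shows "finite F \<and> real (card F) \<le> l / r + 1"
proof -
  obtain X where X: "X \<subseteq> {0..l}" "F = g ` X" using F(1) by (meson subset_imageE)
  define k where "k = (\<lambda>s. nat \<lfloor>s / r\<rfloor>)"
  have inj: "inj_on k X"
  proof (rule inj_onI)
    fix s t assume st: "s \<in> X" "t \<in> X" "k s = k t"
    then have "\<lfloor>s / r\<rfloor> = \<lfloor>t / r\<rfloor>"
      using X(1) \<open>0 < r\<close> by (auto simp: k_def subset_iff nat_eq_iff2)
    then have "\<bar>s / r - t / r\<bar> < 1" by linarith
    then have "\<bar>s - t\<bar> < r"
      using \<open>0 < r\<close> by (simp add: abs_less_iff divide_simps)
    then have "dist (g s) (g t) < r"
      using isometric_on_segmentD[OF g, of s t] subsetD[OF X(1) st(1)] subsetD[OF X(1) st(2)]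
      by auto
    then have "g s = g t" using F(2) X(2) st unfolding separated_def by fastforce
    then show "s = t"
      using inj_onD[OF isometric_on_segment_inj[OF g]] subsetD[OF X(1)] st(1,2) by blast
  qed
  have sub: "k ` X \<subseteq> {0..nat \<lfloor>l / r\<rfloor>}"
    using X(1) \<open>0 < r\<close> by (auto simp: k_def subset_iff intro!: nat_mono floor_mono divide_right_mono)
  have fin: "finite X" using inj sub by (meson finite_atLeastAtMost inj_on_finite)
  have "card F \<le> card X" unfolding X(2) by (rule card_image_le[OF fin])
  also have "card X \<le> nat \<lfloor>l / r\<rfloor> + 1"
    using card_inj_on_le[OF inj sub] by simp
  finally have "real (card F) \<le> real (nat \<lfloor>l / r\<rfloor>) + 1" by linarith
  also have "real (nat \<lfloor>l / r\<rfloor>) \<le> l / r" using assms(2,3) by simp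
  finally show ?thesis using fin X(2) by auto
qed

context realized_tree
begin

lemma card_separated_le:
  assumes "0 < r" and F: "F \<subseteq> T" "separated r F"
  shows "real (card F) \<le> sum len E / r + real (card E) + real (card V)"
proof -
  have piece: "finite (F \<inter> \<sigma> e) \<and> real (card (F \<inter> \<sigma> e)) \<le> len e / r + 1" if "e \<in> E" for e
  proof -
    obtain u w where e: "e = {u, w}" "{u, w} \<in> E" using \<open>e \<in> E\<close> by (rule edge_cases)
    then obtain g where g: "g ` {0..len e} = \<sigma> e" "isometric_on_segment g (len e)"
      using edge_parametrization by metis
    show ?thesis
      by (rule card_separated_segment_le[OF g(2)])
        (use len_pos[OF that] g(1) assms in \<open>auto simp: separated_def\<close>)
  qed
  have fin: "finite (\<Union>e\<in>E. F \<inter> \<sigma> e)" using finite_E piece by blast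
  have "F \<subseteq> V \<union> (\<Union>e\<in>E. F \<inter> \<sigma> e)" using F(1) T_eq by auto
  then have "card F \<le> card (V \<union> (\<Union>e\<in>E. F \<inter> \<sigma> e))"
    by (rule card_mono[OF finite_UnI[OF finite_V fin]])
  also have "\<dots> \<le> card V + card (\<Union>e\<in>E. F \<inter> \<sigma> e)" by (rule card_Un_le)
  also have "card (\<Union>e\<in>E. F \<inter> \<sigma> e) \<le> (\<Sum>e\<in>E. card (F \<inter> \<sigma> e))"
    by (rule card_UN_le[OF finite_E])
  finally have "real (card F) \<le> real (card V) + (\<Sum>e\<in>E. real (card (F \<inter> \<sigma> e)))"
    by (simp flip: of_nat_sum of_nat_add)
  also have "(\<Sum>e\<in>E. real (card (F \<inter> \<sigma> e))) \<le> (\<Sum>e\<in>E. len e / r + 1)"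
    using piece by (intro sum_mono) auto
  also have "\<dots> = sum len E / r + real (card E)"
    by (simp add: sum.distrib sum_divide_distrib)
  finally show ?thesis by simp
qed

text \<open>
  On each edge take the points at distances \<open>r, 2r, \<dots>\<close> from one end that also have distance at
  least \<open>r\<close> from the other end. Points chosen on different edges are separated, since a chain
  between them passes through an end of an edge.
\<close>

lemma ex_large_separated:
  assumes "0 < r"
  shows "\<exists>F\<subseteq>T. separated r F \<and> sum len E / r - 2 * real (card E) \<le> real (card F)"
proof -
  have "\<forall>e\<in>E. \<exists>X. X \<subseteq> \<sigma> e \<and> finite X \<and> separated r X \<and> len e / r - 2 \<le> real (card X) \<and>
          (\<forall>x\<in>X. \<forall>a\<in>e. r \<le> dist x a)"
  proof
    fix e assume e: "e \<in> E"
    obtain u w where uw: "e = {u, w}" "{u, w} \<in> E" using e by (rule edge_cases)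
    obtain g where g: "g 0 = u" "g (len e) = w" "g ` {0..len e} = \<sigma> e"
        "isometric_on_segment g (len e)"
      using edge_parametrization[OF uw(2)] uw(1) by metis
    define K where "K = nat \<lfloor>len e / r\<rfloor>"
    have K: "len e / r - 1 \<le> real K" "real K \<le> len e / r"
      using len_pos[OF e] assms unfolding K_def by (linarith, simp)
    have Kr: "real K * r \<le> len e" using K(2) assms by (simp add: field_simps)
    have pos: "r \<le> real k * r \<and> real k * r \<le> len e - r" if "k \<in> {1..<K}" for k
    proof -
      have "1 \<le> real k" "real k + 1 \<le> real K" using that by auto
      then have "1 * r \<le> real k * r" "(real k + 1) * r \<le> real K * r"
        using assms by (auto intro: mult_right_mono)
      then show ?thesis using Kr by (simp add: algebra_simps)
    qed
    have in_seg: "real k * r \<in> {0..len e}" if "k \<in> {1..<K}" for k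
      using pos[OF that] assms by auto
    have dist_g: "dist (g (real j * r)) (g (real k * r)) = \<bar>real j - real k\<bar> * r"
      if "j \<in> {1..<K}" "k \<in> {1..<K}" for j k
    proof -
      have "dist (g (real j * r)) (g (real k * r)) = \<bar>real j * r - real k * r\<bar>"
        using isometric_on_segmentD[OF g(4)] in_seg[OF that(1)] in_seg[OF that(2)] by auto
      also have "\<dots> = \<bar>real j - real k\<bar> * r"
        using assms by (simp add: abs_mult flip: left_diff_distrib)
      finally show ?thesis .
    qed
    define X where "X = (\<lambda>k. g (real k * r)) ` {1..<K}"
    have "inj_on (\<lambda>k. g (real k * r)) {1..<K}"
    proof (rule inj_onI)
      fix j k assume jk: "j \<in> {1..<K}" "k \<in> {1..<K}" "g (real j * r) = g (real k * r)"
      then have "\<bar>real j - real k\<bar> * r = 0" using dist_g[OF jk(1,2)] by simp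
      then show "j = k" using assms by simp
    qed
    then have "card X = K - 1" unfolding X_def by (simp add: card_image)
    then have "len e / r - 2 \<le> real (card X)" using K(1) by linarith
    moreover have "separated r X"
      unfolding separated_def X_def
    proof (safe)
      fix j k assume jk: "j \<in> {1..<K}" "k \<in> {1..<K}" "g (real j * r) \<noteq> g (real k * r)"
      then have "1 \<le> \<bar>real j - real k\<bar>" by (cases j k rule: linorder_cases) auto
      then have "1 * r \<le> \<bar>real j - real k\<bar> * r" using assms by (intro mult_right_mono) auto
      then show "r \<le> dist (g (real j * r)) (g (real k * r))" using dist_g[OF jk(1,2)] by simp
    qed
    moreover have "r \<le> dist x a" if xa: "x \<in> X" "a \<in> e" for x a
    proof -
      obtain k where k: "k \<in> {1..<K}" "x = g (real k * r)" using xa(1) by (auto simp: X_def)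
      have "dist x (g 0) = \<bar>real k * r - 0\<bar>" "dist x (g (len e)) = \<bar>real k * r - len e\<bar>"
        unfolding k(2) using in_seg[OF k(1)] len_pos[OF e]
        by (intro isometric_on_segmentD[OF g(4)]; simp)+
      then show ?thesis using pos[OF k(1)] xa(2) uw(1) g(1,2) by auto
    qed
    moreover have "X \<subseteq> \<sigma> e" using in_seg g(3) by (auto simp: X_def)
    moreover have "finite X" by (simp add: X_def)
    ultimately show "\<exists>X. X \<subseteq> \<sigma> e \<and> finite X \<and> separated r X \<and> len e / r - 2 \<le> real (card X) \<and>
          (\<forall>x\<in>X. \<forall>a\<in>e. r \<le> dist x a)"
      by blast
  qed
  from bchoice[OF this] obtain X where
    *: "\<forall>e\<in>E. X e \<subseteq> \<sigma> e \<and> finite (X e) \<and> separated r (X e) \<and>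
          len e / r - 2 \<le> real (card (X e)) \<and> (\<forall>x\<in>X e. \<forall>a\<in>e. r \<le> dist x a)"
    by blast
  then have X: "X e \<subseteq> \<sigma> e" "finite (X e)" "separated r (X e)" "len e / r - 2 \<le> real (card (X e))"
      "\<And>x a. x \<in> X e \<Longrightarrow> a \<in> e \<Longrightarrow> r \<le> dist x a" if "e \<in> E" for e
    using that by auto
  have far: "r \<le> dist x y" "x \<noteq> y"
    if ef: "e \<in> E" "f \<in> E" "e \<noteq> f" and xy: "x \<in> X e" "y \<in> X f" for e f x y
  proof -
    have "y \<notin> f" using X(5)[OF ef(2) xy(2), of y] assms by auto
    then have "y \<notin> \<sigma> e" using edge_Int_edge[OF ef] X(1)[OF ef(2)] xy by auto
    moreover have "x \<in> \<sigma> e" using X(1) ef xy by auto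
    moreover have "x \<in> T" "y \<in> T" using X(1) ef xy edge_subset_T by blast+
    ultimately obtain a where "a \<in> e" "dist x a \<le> dist x y"
      using broken_path_leaves_edge_through_end[OF path_metric ef(1)] by blast
    then show "r \<le> dist x y" using X(5)[OF ef(1) xy(1)] by fastforce
    then show "x \<noteq> y" using assms by auto
  qed
  let ?F = "\<Union>e\<in>E. X e"
  have "separated r ?F"
    unfolding separated_def
  proof (intro ballI impI)
    fix x y assume "x \<in> ?F" "y \<in> ?F" and "x \<noteq> y"
    then obtain e f where "e \<in> E" "f \<in> E" "x \<in> X e" "y \<in> X f" by auto
    then show "r \<le> dist x y"
      using far(1)[of e f x y] X(3)[of e] \<open>x \<noteq> y\<close> by (cases "e = f") (auto simp: separated_def)
  qed
  moreover have "?F \<subseteq> T" using X(1) edge_subset_T by blast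
  moreover have "sum len E / r - 2 * real (card E) \<le> real (card ?F)"
  proof -
    have "sum len E / r - 2 * real (card E) = (\<Sum>e\<in>E. len e / r - 2)"
      by (simp add: sum_subtractf sum_divide_distrib)
    also have "\<dots> \<le> (\<Sum>e\<in>E. real (card (X e)))" using X(4) by (intro sum_mono) auto
    also have "\<dots> = real (card ?F)"
      using finite_E X(2) far(2) by (subst card_UN_disjoint) fastforce+
    finally show ?thesis .
  qed
  ultimately show ?thesis by blast
qed

end

text \<open>
  The bounds give \<open>L / r - L' / r \<le> c\<close> for the two edge sums, with \<open>c\<close> independent of \<open>r\<close>. This fails
  for small \<open>r\<close> if \<open>L > L'\<close>.
\<close>

lemma edge_sum_le:
  assumes "realized_tree V E len \<sigma> T" and "realized_tree V' E' len' \<sigma>' T"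
  shows "sum len E \<le> sum len' E'"
proof (rule ccontr)
  interpret a: realized_tree V E len \<sigma> T by fact
  interpret b: realized_tree V' E' len' \<sigma>' T by fact
  define c where "c = 2 * real (card E) + real (card E') + real (card V')"
  define d where "d = sum len E - sum len' E'"
  assume "\<not> ?thesis"
  then have d: "d > 0" by (simp add: d_def)
  define r where "r = d / (c + 1)"
  have c: "c \<ge> 0" by (simp add: c_def)
  have r: "r > 0" using d c by (simp add: r_def)
  obtain F where F: "F \<subseteq> T" "separated r F"
      "sum len E / r - 2 * real (card E) \<le> real (card F)"
    using a.ex_large_separated[OF r] by blast
  have "sum len E / r - sum len' E' / r \<le> c"
    using F(3) b.card_separated_le[OF r F(1,2)] unfolding c_def by linarith
  then have "d / r \<le> c" by (simp add: d_def diff_divide_distrib)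
  moreover have "d / r = c + 1" using d c by (simp add: r_def)
  ultimately show False by simp
qed

lemma (in realized_tree) tree_length_eq: "tree_length T = sum len E"
  unfolding tree_length_def
proof (rule the_equality)
  have "metric_tree_structure V E len T"
    using realized_tree_axioms metric_tree_structure_iff_realized_tree by blast
  then show "\<exists>V E' len'. metric_tree_structure V E' len' T \<and> sum len E = sum len' E'"
    by blast
next
  fix L assume "\<exists>V' E' len'. metric_tree_structure V' E' len' T \<and> L = sum len' E'"
  then obtain V' E' len' \<sigma>' where "realized_tree V' E' len' \<sigma>' T" "L = sum len' E'"
    by (auto simp: metric_tree_structure_iff_realized_tree)
  then show "L = sum len E"
    using edge_sum_le[OF realized_tree_axioms] edge_sum_le[OF _ realized_tree_axioms]
    by (metis antisym)
qed

lemma finite_metric_tree_iff_realized: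
  "finite_metric_tree T \<longleftrightarrow> (\<exists>V E len \<sigma>. realized_tree V E len \<sigma> T)"
  by (simp add: finite_metric_tree_def metric_tree_structure_iff_realized_tree)

lemma finite_metric_treeE:
  assumes "finite_metric_tree T"
  obtains V E len \<sigma> where "realized_tree V E len \<sigma> T"
  using assms by (auto simp: finite_metric_tree_iff_realized)

lemma finite_metric_tree_compact: "finite_metric_tree T \<Longrightarrow> compact T"
  by (erule finite_metric_treeE) (rule realized_tree.T_compact)

lemma finite_metric_tree_connected: "finite_metric_tree T \<Longrightarrow> connected T"
  by (erule finite_metric_treeE) (rule realized_tree.T_connected)

lemma tree_length_pos_iff: "finite_metric_tree T \<Longrightarrow> 0 < tree_length T \<longleftrightarrow> nontrivial_tree T"
  by (erule finite_metric_treeE)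
    (simp add: realized_tree.tree_length_eq realized_tree.length_pos_iff nontrivial_tree_def)


section \<open>Subdivision and additivity\<close>

lemma broken_path_lift:
  assumes "broken_path R x y L" and "\<And>a b. R a b \<Longrightarrow> broken_path S a b (dist a b)"
  shows "broken_path S x y L"
  using assms(1)
proof induction
  case (step x y z L)
  then show ?case using assms(2) broken_path_trans by blast
qed (rule broken_path.refl)

text \<open>
  A point inside an edge splits its arc into two. A step of a chain that jumps over the new vertex
  is replaced by two steps through it, which does not change the length.
\<close>

lemma (in realized_tree) subdivide_at:
  assumes "m \<in> T"
  shows "\<exists>V' E' len' \<sigma>'. realized_tree V' E' len' \<sigma>' T \<and> m \<in> V'"
proof (cases "m \<in> V")
  case True
  then show ?thesis using realized_tree_axioms by blast
next
  case m: False
  obtain e where e: "e \<in> E" "m \<in> \<sigma> e" using assms m T_eq by auto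
  obtain u w where uw: "e = {u, w}" "{u, w} \<in> E" "u \<in> V" "w \<in> V" "u \<noteq> w"
    using e(1) by (rule edge_cases)
  define l where "l = len e"
  obtain g where g: "g 0 = u" "g l = w" "g ` {0..l} = \<sigma> e" "isometric_on_segment g l"
    using edge_parametrization[OF uw(2)] unfolding l_def uw(1) .
  obtain t where t: "0 \<le> t" "t \<le> l" "g t = m" using e(2) g(3) by force
  have "t \<noteq> 0" "t \<noteq> l" using t(3) g(1,2) uw m by auto
  then have t': "0 < t" "t < l" using t by auto
  have um: "u \<noteq> m" "w \<noteq> m" using uw m by auto
  define X where "X = g ` {0..t}"
  define Y where "Y = g ` {t..l}"
  have XY: "X \<inter> Y = {m}"
    unfolding X_def Y_def using isometric_on_segment_image_Int[OF g(4) t(1,2)] t(3) by simp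
  have XY_Un: "\<sigma> e = X \<union> Y"
  proof -
    have "{0..l} = {0..t} \<union> {t..l}" using t by auto
    then show ?thesis unfolding X_def Y_def g(3)[symmetric] by (simp add: image_Un)
  qed
  have u_in: "u \<in> X" using g(1) t by (force simp: X_def)
  have w_in: "w \<in> Y" using g(2) t by (force simp: Y_def)
  have m_in: "m \<in> X" "m \<in> Y" using XY by auto
  have u_out: "u \<notin> Y" and w_out: "w \<notin> X" using XY u_in w_in um by auto
  have eV: "\<sigma> e \<inter> V = {u, w}" using edge_Int_vertices[OF e(1)] uw(1) by simp
  have XV: "X \<inter> insert m V = {u, m}" and YV: "Y \<inter> insert m V = {m, w}"
    using eV XY_Un u_in w_in u_out w_out m_in by auto
  let ?E = "insert {u, m} (insert {m, w} (E - {{u, w}}))"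
  define len' where "len' = len({u, m} := t, {m, w} := l - t)"
  define \<sigma>' where "\<sigma>' = \<sigma>({u, m} := X, {m, w} := Y)"
  have ne: "{u, m} \<noteq> {m, w}" using uw(5) by (auto simp: doubleton_eq_iff)
  have new: "len' {u, m} = t" "len' {m, w} = l - t" "\<sigma>' {u, m} = X" "\<sigma>' {m, w} = Y"
    using ne by (auto simp: len'_def \<sigma>'_def)
  have m_notin: "m \<notin> f" if "f \<in> E" for f
    using that m E_doubletons by auto
  have old: "len' f = len f" "\<sigma>' f = \<sigma> f" if "f \<in> E" for f
    using m_notin[OF that] by (auto simp: len'_def \<sigma>'_def)
  have f_e: "\<sigma> f \<inter> \<sigma> e = f \<inter> {u, w}" if "f \<in> E - {{u, w}}" for f
    using edge_Int_edge[of f e] that e(1) uw(1) by auto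
  have Xf: "X \<inter> \<sigma> f = {u, m} \<inter> f" and Yf: "Y \<inter> \<sigma> f = {m, w} \<inter> f" if "f \<in> E - {{u, w}}" for f
  proof -
    have "X \<inter> \<sigma> f = X \<inter> (\<sigma> f \<inter> \<sigma> e)" "Y \<inter> \<sigma> f = Y \<inter> (\<sigma> f \<inter> \<sigma> e)" using XY_Un by auto
    then show "X \<inter> \<sigma> f = {u, m} \<inter> f" "Y \<inter> \<sigma> f = {m, w} \<inter> f"
      unfolding f_e[OF that] using u_in w_in u_out w_out m_notin[of f] that by auto
  qed
  have mf: "m \<notin> \<sigma> f" if "f \<in> E - {{u, w}}" for f
    using f_e[OF that] e(2) m_notin[of f] that by blast
  have "realized_tree (insert m V) ?E len' \<sigma>' T"
  proof
    show "combinatorial_tree (insert m V) ?E"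
      using combinatorial uw(2) m by (rule combinatorial_tree_subdivide)
  next
    fix f assume "f \<in> ?E"
    then consider "f = {u, m}" | "f = {m, w}" | "f \<in> E" by blast
    then show "0 < len' f" by cases (use new old t' len_pos in auto)
  next
    fix a b assume "{a, b} \<in> ?E"
    then consider "{a, b} = {u, m}" | "{a, b} = {m, w}" | "{a, b} \<in> E" by blast
    then show "geodesic_arc a b (len' {a, b}) (\<sigma>' {a, b})"
    proof cases
      case 1
      have "geodesic_arc u m t X"
        using geodesic_arc_subsegment[OF g(4), of 0 t] t g(1) by (simp add: X_def)
      moreover have "(a = u \<and> b = m) \<or> (a = m \<and> b = u)" using 1 by (auto simp: doubleton_eq_iff)
      ultimately show ?thesis unfolding 1 new using geodesic_arc_commute by blast
    next
      case 2
      have "geodesic_arc m w (l - t) Y"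
        using geodesic_arc_subsegment[OF g(4), of t l] t g(2) by (simp add: Y_def)
      moreover have "(a = m \<and> b = w) \<or> (a = w \<and> b = m)" using 2 by (auto simp: doubleton_eq_iff)
      ultimately show ?thesis unfolding 2 new using geodesic_arc_commute by blast
    next
      case 3
      then show ?thesis using arc old by simp
    qed
  next
    have "(\<Union>f\<in>?E. \<sigma>' f) = X \<union> Y \<union> (\<Union>f\<in>E - {{u, w}}. \<sigma> f)"
      using new old by auto
    also have "\<dots> = (\<Union>f\<in>E. \<sigma> f)"
      using XY_Un e(1) uw(1) by blast
    finally show "T = insert m V \<union> (\<Union>f\<in>?E. \<sigma>' f)" using T_eq assms by auto
  next
    fix f assume "f \<in> ?E"
    then consider "f = {u, m}" | "f = {m, w}" | "f \<in> E - {{u, w}}" by blast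
    then show "\<sigma>' f \<inter> insert m V = f"
    proof cases
      case 3
      then show ?thesis using old mf[OF 3] edge_Int_vertices[of f] by simp
    qed (use new XV YV in auto)
  next
    fix f h assume fh: "f \<in> ?E" "h \<in> ?E" "f \<noteq> h"
    consider "f = {u, m}" "h = {m, w}" | "f = {m, w}" "h = {u, m}"
      | "f = {u, m}" "h \<in> E - {{u, w}}" | "f = {m, w}" "h \<in> E - {{u, w}}"
      | "h = {u, m}" "f \<in> E - {{u, w}}" | "h = {m, w}" "f \<in> E - {{u, w}}"
      | "f \<in> E - {{u, w}}" "h \<in> E - {{u, w}}"
    proof -
      have "f = {u, m} \<or> f = {m, w} \<or> f \<in> E - {{u, w}}" using fh(1) by blast
      moreover have "h = {u, m} \<or> h = {m, w} \<or> h \<in> E - {{u, w}}" using fh(2) by blast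
      ultimately show thesis using fh(3) that by metis
    qed
    then show "\<sigma>' f \<inter> \<sigma>' h = f \<inter> h"
    proof cases
      case 1
      then show ?thesis using new XY uw(5) um by auto
    next
      case 2
      then show ?thesis using new XY uw(5) um by auto
    next
      case 3
      then show ?thesis using new old[of h] Xf[of h] by simp
    next
      case 4
      then show ?thesis using new old[of h] Yf[of h] by simp
    next
      case 5
      then show ?thesis using new old[of f] Xf[of f] by (simp add: Int_commute)
    next
      case 6
      then show ?thesis using new old[of f] Yf[of f] by (simp add: Int_commute)
    next
      case 7
      then show ?thesis using old edge_Int_edge fh(3) by simp
    qed
  next
    fix x y assume xy: "x \<in> T" "y \<in> T"
    let ?S = "\<lambda>a b. \<exists>f\<in>?E. a \<in> \<sigma>' f \<and> b \<in> \<sigma>' f"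
    have inX: "broken_path ?S a b (dist a b)" if "a \<in> X" "b \<in> X" for a b
      using that new by (intro broken_path_single bexI[of _ "{u, m}"]) auto
    have inY: "broken_path ?S a b (dist a b)" if "a \<in> Y" "b \<in> Y" for a b
      using that new by (intro broken_path_single bexI[of _ "{m, w}"]) auto
    have thru_m: "dist a b = dist a m + dist m b" if ab: "a \<in> X" "b \<in> Y" for a b
    proof -
      obtain r where r: "0 \<le> r" "r \<le> t" "a = g r" using ab(1) by (auto simp: X_def)
      obtain s where s: "t \<le> s" "s \<le> l" "b = g s" using ab(2) by (auto simp: Y_def)
      show ?thesis
        using isometric_on_segmentD[OF g(4), of r s] isometric_on_segmentD[OF g(4), of r t]
          isometric_on_segmentD[OF g(4), of t s] r s t by auto
    qed
    show "broken_path ?S x y (dist x y)"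
      using path_metric[OF xy]
    proof (rule broken_path_lift)
      fix a b assume "same_edge a b"
      then obtain f where f: "f \<in> E" "a \<in> \<sigma> f" "b \<in> \<sigma> f" by blast
      show "broken_path ?S a b (dist a b)"
      proof (cases "f = e")
        case True
        then consider "a \<in> X" "b \<in> X" | "a \<in> Y" "b \<in> Y" | "a \<in> X" "b \<in> Y" | "a \<in> Y" "b \<in> X"
          using f XY_Un by auto
        then show ?thesis
        proof cases
          case 3
          show ?thesis
            unfolding thru_m[OF 3]
            by (rule broken_path_trans[OF inX[OF 3(1) m_in(1)] inY[OF m_in(2) 3(2)]])
        next
          case 4
          have sum: "dist a b = dist a m + dist m b"
            using thru_m[OF 4(2,1)] dist_commute[of a b] dist_commute[of a m] dist_commute[of m b]
            by linarith
          show ?thesis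
            unfolding sum
            by (rule broken_path_trans[OF inY[OF 4(1) m_in(2)] inX[OF m_in(1) 4(2)]])
        qed (use inX inY in auto)
      next
        case False
        then show ?thesis
          using f uw(1) old[OF f(1)] by (intro broken_path_single bexI[of _ f]) auto
      qed
    qed
  qed
  then show ?thesis by blast
qed

lemma finite_metric_tree_vertexE:
  assumes "finite_metric_tree T" and "v \<in> T"
  obtains V E len \<sigma> where "realized_tree V E len \<sigma> T" "v \<in> V"
proof -
  obtain V E len \<sigma> where "realized_tree V E len \<sigma> T" using assms(1) by (rule finite_metric_treeE)
  from realized_tree.subdivide_at[OF this assms(2)] show thesis using that by blast
qed

context realized_tree
begin

text \<open>
  An edge without the vertex \<open>v\<close> is connected because \<open>v\<close> is at most an end of it, so the disjoint
  relatively closed sets \<open>C - {v}\<close> and \<open>D - {v}\<close> cannot both meet it.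
\<close>

lemma edge_in_one_piece:
  assumes v: "v \<in> V" and T: "T = C \<union> D" and cl: "closed C" "closed D" and CD: "C \<inter> D = {v}"
    and e: "e \<in> E"
  shows "\<sigma> e \<subseteq> C \<or> \<sigma> e \<subseteq> D"
proof -
  obtain u w where uw: "e = {u, w}" "{u, w} \<in> E" "u \<in> V" "w \<in> V" "u \<noteq> w"
    using e by (rule edge_cases)
  define l where "l = len e"
  obtain g where g: "g 0 = u" "g l = w" "g ` {0..l} = \<sigma> e" "isometric_on_segment g l"
    using edge_parametrization[OF uw(2)] unfolding l_def uw(1) .
  have l: "0 < l" using len_pos[OF e] by (simp add: l_def)
  have conn: "connected (g ` I)" if "I \<subseteq> {0..l}" "connected I" for I
    using that isometric_on_segment_continuous[OF g(4)]
    by (meson connected_continuous_image continuous_on_subset)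
  have remove: "\<sigma> e - {g s} = g ` ({0..l} - {s})" if "s \<in> {0..l}" for s
    using inj_on_image_set_diff[OF isometric_on_segment_inj[OF g(4)], of "{0..l}" "{s}"] g(3) that
    by auto
  have "connected (\<sigma> e - {v})"
  proof -
    consider "v = u" | "v = w" | "v \<notin> \<sigma> e" using edge_Int_vertices[OF e] uw(1) v by auto
    then show ?thesis
    proof cases
      case 1
      have "{0..l} - {0} = {0<..l}" by auto
      then show ?thesis using 1 remove[of 0] g(1) l conn[of "{0<..l}"] by auto
    next
      case 2
      have "{0..l} - {l} = {0..<l}" by auto
      then show ?thesis using 2 remove[of l] g(2) l conn[of "{0..<l}"] by auto
    next
      case 3
      then show ?thesis using edge_connected[OF e] by simp
    qed
  qed
  moreover have "\<sigma> e - {v} \<subseteq> C \<union> D" using edge_subset_T[OF e] T by blast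
  ultimately have "C \<inter> (\<sigma> e - {v}) = {} \<or> D \<inter> (\<sigma> e - {v}) = {}"
    using CD cl by (intro connected_closedD) auto
  then show ?thesis using edge_subset_T[OF e] T CD by blast
qed

text \<open>
  Collapsing \<open>D\<close> to \<open>v\<close> maps \<open>T\<close> onto \<open>C\<close>. It takes paths of edges to paths of edges, and it does
  not lengthen chains, so \<open>C\<close> inherits both connectedness and the path metric.
\<close>

lemma restrict_to_piece:
  assumes v: "v \<in> V" and T: "T = C \<union> D" and cl: "closed C" "closed D" and CD: "C \<inter> D = {v}"
  shows "realized_tree (V \<inter> C) {e \<in> E. \<sigma> e \<subseteq> C} len \<sigma> C"
proof
  let ?E = "{e \<in> E. \<sigma> e \<subseteq> C}"
  note one_piece = edge_in_one_piece[OF v T cl CD]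
  define r where "r = (\<lambda>z. if z \<in> C then z else v)"
  have r_C: "r z = z" if "z \<in> C" for z using that by (simp add: r_def)
  have r_D: "r z = v" if "z \<in> D" for z using that CD by (auto simp: r_def)
  have conn: "(a, b) \<in> (adj ?E)\<^sup>*" if "a \<in> V \<inter> C" "b \<in> V \<inter> C" for a b
  proof -
    have "(a, b) \<in> (adj E)\<^sup>*" using vertices_connected that by blast
    then have "(r a, r b) \<in> (adj ?E)\<^sup>*"
    proof (rule rtrancl_map_rtrancl)
      fix x y assume "(x, y) \<in> adj E"
      then have xy: "{x, y} \<in> E" by (simp add: adj_iff)
      have ends: "x \<in> \<sigma> {x, y}" "y \<in> \<sigma> {x, y}" using ends_in_edge[OF xy] by auto
      show "(r x, r y) \<in> (adj ?E)\<^sup>*"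
      proof (cases "\<sigma> {x, y} \<subseteq> C")
        case True
        then have "x \<in> C" "y \<in> C" using ends by auto
        then show ?thesis using True xy by (intro r_into_rtrancl) (simp add: adj_iff r_C)
      next
        case False
        then have "x \<in> D" "y \<in> D" using one_piece[OF xy] ends by auto
        then show ?thesis by (simp add: r_D)
      qed
    qed
    then show ?thesis using that r_C by simp
  qed
  have bridges: "(a, b) \<notin> (adj (?E - {{a, b}}))\<^sup>*" if "{a, b} \<in> ?E" for a b
  proof -
    have "(adj (?E - {{a, b}}))\<^sup>* \<subseteq> (adj (E - {{a, b}}))\<^sup>*"
      by (rule rtrancl_mono) (auto simp: adj_def)
    then show ?thesis using bridge[of a b] that by blast
  qed
  have sub: "?E \<subseteq> {{u, w} | u w. u \<in> V \<inter> C \<and> w \<in> V \<inter> C \<and> u \<noteq> w}"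
  proof
    fix e assume "e \<in> ?E"
    then have e: "e \<in> E" "\<sigma> e \<subseteq> C" by auto
    obtain a b where ab: "e = {a, b}" "a \<in> V" "b \<in> V" "a \<noteq> b" using edge_cases[OF e(1)] by metis
    have "{a, b} \<subseteq> C" using ends_in_edge[OF e(1)] e(2) unfolding ab(1) by (rule subset_trans)
    then show "e \<in> {{u, w} | u w. u \<in> V \<inter> C \<and> w \<in> V \<inter> C \<and> u \<noteq> w}"
      unfolding mem_Collect_eq using ab by (intro exI[of _ a] exI[of _ b]) simp
  qed
  have "v \<in> V \<inter> C" using v CD by blast
  then have "V \<inter> C \<noteq> {}" by blast
  then show "combinatorial_tree (V \<inter> C) ?E"
    unfolding combinatorial_tree_iff_bridges using finite_V sub
    by (intro conjI ballI allI impI conn bridges) simp_all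
  show "0 < len e" if "e \<in> ?E" for e using that len_pos by blast
  show "geodesic_arc a b (len {a, b}) (\<sigma> {a, b})" if "{a, b} \<in> ?E" for a b using that arc by blast
  show "C = V \<inter> C \<union> (\<Union>e\<in>?E. \<sigma> e)"
  proof -
    have "x \<in> V \<inter> C \<union> (\<Union>e\<in>?E. \<sigma> e)" if x: "x \<in> C" for x
    proof (cases "x \<in> V")
      case False
      then obtain e where e: "e \<in> E" "x \<in> \<sigma> e" using x T T_eq by auto
      have "\<not> \<sigma> e \<subseteq> D" using e(2) x CD v False by auto
      then show ?thesis using one_piece[OF e(1)] e by auto
    qed (use x in auto)
    then show ?thesis by blast
  qed
  show "\<sigma> e \<inter> (V \<inter> C) = e" if "e \<in> ?E" for e
    using that edge_Int_vertices[of e] by blast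
  show "\<sigma> e \<inter> \<sigma> f = e \<inter> f" if "e \<in> ?E" "f \<in> ?E" "e \<noteq> f" for e f
    using that edge_Int_edge by blast
  show "broken_path (\<lambda>a b. \<exists>e\<in>?E. a \<in> \<sigma> e \<and> b \<in> \<sigma> e) x y (dist x y)"
    if xy: "x \<in> C" "y \<in> C" for x y
  proof -
    let ?S = "\<lambda>a b. \<exists>e\<in>?E. a \<in> \<sigma> e \<and> b \<in> \<sigma> e"
    have "\<exists>L'\<le>L. broken_path ?S (r x) (r y) L'" if "broken_path same_edge x y L" for x y L
      using that
    proof (induction rule: broken_path.induct)
      case (refl x)
      show ?case using broken_path.refl by blast
    next
      case (step x y z L)
      then obtain L' where L': "L' \<le> L" "broken_path ?S (r y) (r z) L'" by blast
      obtain e where e: "e \<in> E" "x \<in> \<sigma> e" "y \<in> \<sigma> e" using step(1) by blast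
      show ?case
      proof (cases "\<sigma> e \<subseteq> C")
        case True
        then have "x \<in> C" "y \<in> C" using e by auto
        moreover have "?S x y" using True e by blast
        ultimately have "broken_path ?S (r x) (r z) (dist x y + L')"
          using L'(2) broken_path.step[of ?S x y "r z" L'] by (simp add: r_C)
        then show ?thesis using L'(1) by (intro exI[of _ "dist x y + L'"]) simp
      next
        case False
        then have "x \<in> D" "y \<in> D" using e one_piece by auto
        then have "r x = r y" by (simp add: r_D)
        moreover have "L' \<le> dist x y + L" using L'(1) zero_le_dist[of x y] by linarith
        ultimately show ?thesis using L'(2) by auto
      qed
    qed
    moreover have "broken_path same_edge x y (dist x y)" using path_metric xy T by simp
    ultimately obtain L where L: "L \<le> dist x y" "broken_path ?S (r x) (r y) L" by blast
    have L': "broken_path ?S x y L" using L(2) unfolding r_C[OF xy(1)] r_C[OF xy(2)] .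
    have "L = dist x y" using dist_le_broken_path[OF L'] L(1) by linarith
    then show ?thesis using L' by simp
  qed
qed

end

text \<open>
  Once \<open>v\<close> is made a vertex, every edge lies in exactly one of the two sets, and each set is realized
  by the edges that it contains.
\<close>

lemma cut_at_point:
  assumes tree: "finite_metric_tree T" and T: "T = C \<union> D" and cl: "closed C" "closed D"
    and CD: "C \<inter> D = {v}"
  shows "finite_metric_tree C" and "finite_metric_tree D"
    and "tree_length T = tree_length C + tree_length D"
proof -
  have "v \<in> T" using T CD by auto
  with tree obtain V E len \<sigma> where "realized_tree V E len \<sigma> T" and v: "v \<in> V"
    by (rule finite_metric_tree_vertexE)
  then interpret realized_tree V E len \<sigma> T by simp
  have DC: "D \<inter> C = {v}" and T': "T = D \<union> C" using CD T by auto
  interpret C: realized_tree "V \<inter> C" "{e \<in> E. \<sigma> e \<subseteq> C}" len \<sigma> C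
    by (rule restrict_to_piece[OF v T cl CD])
  interpret D: realized_tree "V \<inter> D" "{e \<in> E. \<sigma> e \<subseteq> D}" len \<sigma> D
    by (rule restrict_to_piece[OF v T' cl(2,1) DC])
  show "finite_metric_tree C" "finite_metric_tree D"
    unfolding finite_metric_tree_iff_realized
    using C.realized_tree_axioms D.realized_tree_axioms by blast+
  let ?EC = "{e \<in> E. \<sigma> e \<subseteq> C}" and ?ED = "{e \<in> E. \<sigma> e \<subseteq> D}"
  have "\<not> (\<sigma> e \<subseteq> C \<and> \<sigma> e \<subseteq> D)" if e: "e \<in> E" for e
  proof
    assume "\<sigma> e \<subseteq> C \<and> \<sigma> e \<subseteq> D"
    then have "e \<subseteq> {v}" using ends_in_edge[OF e] CD by blast
    moreover obtain a b where "e = {a, b}" "a \<noteq> b" using edge_cases[OF e] by metis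
    ultimately show False by simp
  qed
  then have disj: "?EC \<inter> ?ED = {}" by blast
  have "E = ?EC \<union> ?ED"
    using edge_in_one_piece[OF v T cl CD] by auto
  then have "sum len E = sum len (?EC \<union> ?ED)" by (rule arg_cong)
  also have "\<dots> = sum len ?EC + sum len ?ED"
    by (rule sum.union_disjoint[OF C.finite_E D.finite_E disj])
  finally show "tree_length T = tree_length C + tree_length D"
    by (simp only: tree_length_eq C.tree_length_eq D.tree_length_eq)
qed


section \<open>Cutting along an edge\<close>

text \<open>
  The arc \<open>g\<close> joins \<open>P\<close> to \<open>Q\<close>, and deleting its interior separates them. Either side may be a single
  point.
\<close>

definition bridge_arc ::
  "'a::metric_space set \<Rightarrow> 'a set \<Rightarrow> 'a set \<Rightarrow> (real \<Rightarrow> 'a) \<Rightarrow> real \<Rightarrow> bool" where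
  "bridge_arc T P Q g l \<longleftrightarrow>
     0 < l \<and> isometric_on_segment g l \<and> closed P \<and> closed Q \<and> T = P \<union> g ` {0..l} \<union> Q \<and>
     P \<inter> g ` {0..l} = {g 0} \<and> Q \<inter> g ` {0..l} = {g l} \<and> P \<inter> Q = {}"

text \<open>
  The vertices fall into those that can be reached from \<open>u\<close> without the edge \<open>{u, w}\<close> and the
  others; \<open>w\<close> is among the others because the edge is a bridge. All other edges join vertices of
  the same class, so they distribute over the two sides.
\<close>

lemma (in realized_tree) ex_bridge_arc:
  assumes e: "{u, w} \<in> E"
  shows "\<exists>P Q g l. bridge_arc T P Q g l \<and> g 0 = u \<and> g l = w \<and> g ` {0..l} = \<sigma> {u, w}"
proof -
  define e where "e = {u, w}"
  have eE: "e \<in> E" using e by (simp add: e_def)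
  have uw: "u \<in> V" "w \<in> V" "u \<noteq> w" using edge_ends[OF e] by auto
  obtain g where g: "g 0 = u" "g (len e) = w" "g ` {0..len e} = \<sigma> e"
      "isometric_on_segment g (len e)"
    using edge_parametrization[OF e] unfolding e_def .
  define U where "U = {x \<in> V. (u, x) \<in> (adj (E - {e}))\<^sup>*}"
  define side where "side = (\<lambda>X. X \<union> (\<Union>f\<in>{f \<in> E - {e}. f \<subseteq> X}. \<sigma> f))"
  have UV: "U \<subseteq> V" by (auto simp: U_def)
  have u: "u \<in> U" using uw by (simp add: U_def)
  have w: "w \<notin> U" using bridge[OF e] by (simp add: U_def e_def)
  have closed_side: "closed (side X)" if "X \<subseteq> V" for X
  proof -
    have "finite X" using that finite_V finite_subset by blast
    then show ?thesis
      unfolding side_def using finite_E edge_compact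
      by (intro closed_Un closed_UN compact_imp_closed) (auto intro: finite_imp_compact)
  qed
  have side_e: "side X \<inter> \<sigma> e = X \<inter> e" if "X \<subseteq> V" for X
  proof -
    have "\<sigma> f \<inter> \<sigma> e \<subseteq> X \<inter> e" if "f \<in> E - {e}" "f \<subseteq> X" for f
      using edge_Int_edge[of f e] that eE by auto
    moreover have "X \<inter> \<sigma> e = X \<inter> e" using edge_Int_vertices[OF eE] that by blast
    ultimately show ?thesis unfolding side_def by blast
  qed
  have disj: "side U \<inter> side (V - U) = {}"
  proof -
    have "\<sigma> f \<inter> \<sigma> h = {}"
      if fh: "f \<in> E - {e}" "f \<subseteq> U" "h \<in> E - {e}" "h \<subseteq> V - U" for f h
    proof -
      have f: "f \<in> E" "h \<in> E" using fh by auto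
      have "f \<noteq> {}" using edge_cases[OF f(1)] by blast
      then have "f \<noteq> h" using fh(2,4) by blast
      then show "\<sigma> f \<inter> \<sigma> h = {}" using edge_Int_edge[OF f] fh(2,4) by blast
    qed
    moreover have "\<sigma> f \<inter> (V - U) = {}" if "f \<in> E" "f \<subseteq> U" for f
      using edge_Int_vertices[OF that(1)] that(2) by blast
    moreover have "U \<inter> \<sigma> f = {}" if "f \<in> E" "f \<subseteq> V - U" for f
      using edge_Int_vertices[OF that(1)] that(2) UV by blast
    ultimately show ?thesis unfolding side_def by blast
  qed
  have cover: "T = side U \<union> \<sigma> e \<union> side (V - U)"
  proof -
    have classes: "f \<subseteq> U \<or> f \<subseteq> V - U" if f: "f \<in> E - {e}" for f
    proof -
      have fE: "f \<in> E" using f by simp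
      obtain a b where ab: "f = {a, b}" "a \<in> V" "b \<in> V" using edge_cases[OF fE] by metis
      have "(a, b) \<in> adj (E - {e})" "(b, a) \<in> adj (E - {e})"
        using f ab(1) by (simp_all add: adj_iff insert_commute)
      then have "a \<in> U \<longleftrightarrow> b \<in> U"
        unfolding U_def using ab(2,3) by (auto intro: rtrancl_into_rtrancl)
      then show ?thesis using ab by auto
    qed
    have "\<sigma> f \<subseteq> side U \<union> \<sigma> e \<union> side (V - U)" if "f \<in> E" for f
      using classes[of f] that unfolding side_def by blast
    moreover have "V \<subseteq> side U \<union> side (V - U)" unfolding side_def by blast
    moreover have "side U \<subseteq> T" "side (V - U) \<subseteq> T" "\<sigma> e \<subseteq> T"
      using UV eE unfolding side_def T_eq by auto
    ultimately show ?thesis using T_eq by blast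
  qed
  have "side U \<inter> \<sigma> e = {g 0}" "side (V - U) \<inter> \<sigma> e = {g (len e)}"
    using side_e[OF UV] side_e[of "V - U"] u w uw(2) unfolding g(1,2) by (auto simp: e_def)
  then have "bridge_arc T (side U) (side (V - U)) g (len e)"
    unfolding bridge_arc_def g(3) using len_pos[OF eE] g(4) closed_side UV disj cover by blast
  then show ?thesis using g unfolding e_def by blast
qed

lemma bridge_arc_cut:
  assumes br: "bridge_arc T P Q g l" and t: "0 \<le> t" "t \<le> l"
  shows "T = (P \<union> g ` {0..t}) \<union> (g ` {t..l} \<union> Q)"
    and "(P \<union> g ` {0..t}) \<inter> (g ` {t..l} \<union> Q) = {g t}"
    and "closed (P \<union> g ` {0..t})" and "closed (g ` {t..l} \<union> Q)"
proof -
  have iso: "isometric_on_segment g l" and PQ: "P \<inter> Q = {}" "closed P" "closed Q"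
    and T: "T = P \<union> g ` {0..l} \<union> Q"
    and P: "P \<inter> g ` {0..l} = {g 0}" and Q: "Q \<inter> g ` {0..l} = {g l}"
    using br by (auto simp: bridge_arc_def)
  have "{0..l} = {0..t} \<union> {t..l}" using t by auto
  then have arc: "g ` {0..l} = g ` {0..t} \<union> g ` {t..l}" by (metis image_Un)
  show "T = (P \<union> g ` {0..t}) \<union> (g ` {t..l} \<union> Q)" unfolding T arc by auto
  have both: "g ` {0..t} \<inter> g ` {t..l} = {g t}"
    using isometric_on_segment_image_Int[OF iso t] .
  have "P \<inter> g ` {t..l} \<subseteq> {g t}"
  proof
    fix x assume x: "x \<in> P \<inter> g ` {t..l}"
    then have "x \<in> P \<inter> g ` {0..l}" using arc by blast
    then have x0: "x = g 0" using P by simp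
    then have "x \<in> g ` {0..t}" using t by force
    then show "x \<in> {g t}" using x both by blast
  qed
  moreover have "g ` {0..t} \<inter> Q \<subseteq> {g t}"
  proof
    fix x assume x: "x \<in> g ` {0..t} \<inter> Q"
    then have "x \<in> Q \<inter> g ` {0..l}" using arc by blast
    then have "x = g l" using Q by simp
    then have "x \<in> g ` {t..l}" using t by force
    then show "x \<in> {g t}" using x both by blast
  qed
  ultimately show "(P \<union> g ` {0..t}) \<inter> (g ` {t..l} \<union> Q) = {g t}"
    using both PQ(1) by blast
  show "closed (P \<union> g ` {0..t})" "closed (g ` {t..l} \<union> Q)"
    using PQ(2,3) isometric_on_segment_image(2)[OF iso] t
    by (simp_all add: closed_Un compact_imp_closed)
qed

lemma ex_bridge_arc_at:
  assumes "finite_metric_tree T" and "nontrivial_tree T" and "v \<in> T"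
  obtains P Q g l where "bridge_arc T P Q g l" "g 0 = v"
proof -
  obtain V E len \<sigma> where real: "realized_tree V E len \<sigma> T" and v: "v \<in> V"
    using assms(1,3) by (rule finite_metric_tree_vertexE)
  interpret realized_tree V E len \<sigma> T by (rule real)
  have "E \<noteq> {}" using edgeless_iff assms(2) by (simp add: nontrivial_tree_def)
  then obtain e where "e \<in> E" by blast
  then obtain a b where ab: "a \<in> V" "b \<in> V" "a \<noteq> b" using edge_cases by metis
  then obtain x where x: "x \<in> V" "x \<noteq> v" by (cases "a = v") auto
  have "(v, x) \<in> (adj E)\<^sup>*" using vertices_connected[OF v x(1)] .
  then obtain w where "(v, w) \<in> adj E" using x(2) by (auto elim: converse_rtranclE)
  then have "{v, w} \<in> E" by (simp add: adj_iff)
  then show thesis using ex_bridge_arc that by blast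
qed

section \<open>Leaves\<close>

lemma leaves_iff: "x \<in> leaves S \<longleftrightarrow> x \<in> S \<and> S - {x} \<noteq> {} \<and> connected (S - {x})"
proof -
  have *: "(\<exists>!C. C \<in> components (S - {x})) \<longleftrightarrow> (\<exists>C. components (S - {x}) = {C})"
    unfolding Ex1_def by (auto intro!: equalityI)
  show ?thesis
    unfolding leaves_def mem_Collect_eq * components_eq_sing_exists by blast
qed

text \<open>Removing \<open>p\<close> leaves two nonempty relatively closed parts.\<close>

lemma cut_point_not_leaf:
  assumes "closed C" and "closed D" and CD: "C \<inter> D = {p}" and "C \<noteq> {p}" and "D \<noteq> {p}"
  shows "p \<notin> leaves (C \<union> D)"
proof
  assume "p \<in> leaves (C \<union> D)"
  then have "connected (C \<union> D - {p})" by (simp add: leaves_iff)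
  then have "C \<inter> (C \<union> D - {p}) = {} \<or> D \<inter> (C \<union> D - {p}) = {}"
    using assms(1,2) CD by (intro connected_closedD) auto
  then show False using assms(3-5) by blast
qed

text \<open>The tree can be cut at an interior point of an edge, with one end of the edge on each side.\<close>

lemma (in realized_tree) leaves_subset_vertices: "leaves T \<subseteq> V"
proof
  fix x assume x: "x \<in> leaves T"
  show "x \<in> V"
  proof (rule ccontr)
    assume "x \<notin> V"
    moreover have "x \<in> T" using x by (simp add: leaves_iff)
    ultimately obtain e where e: "e \<in> E" "x \<in> \<sigma> e" using T_eq by auto
    obtain u w where uw: "e = {u, w}" "{u, w} \<in> E" "u \<in> V" "w \<in> V" using edge_cases[OF e(1)] by metis
    obtain P Q g l where br: "bridge_arc T P Q g l" and g: "g 0 = u" "g l = w" "g ` {0..l} = \<sigma> e"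
      using ex_bridge_arc[OF uw(2)] unfolding uw(1) by blast
    obtain t where t: "0 \<le> t" "t \<le> l" "x = g t" using e(2) g(3) by force
    have "u \<noteq> x" "w \<noteq> x" using \<open>x \<notin> V\<close> uw by auto
    moreover have "u \<in> P \<union> g ` {0..t}" "w \<in> g ` {t..l} \<union> Q" using t(1,2) g(1,2) by force+
    ultimately have "g t \<notin> leaves T"
      using cut_point_not_leaf[OF bridge_arc_cut(3,4,2)[OF br t(1,2)]]
        bridge_arc_cut(1)[OF br t(1,2)] t(3) by auto
    then show False using x t(3) by simp
  qed
qed

lemma finite_leaves:
  assumes "finite_metric_tree T"
  shows "finite (leaves T)"
proof -
  obtain V E len \<sigma> where "realized_tree V E len \<sigma> T" using assms by (rule finite_metric_treeE)
  then interpret realized_tree V E len \<sigma> T .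
  show ?thesis using leaves_subset_vertices finite_V by (rule finite_subset)
qed

text \<open>
  Let \<open>x\<close> be farthest from \<open>v\<close>. A chain of length \<open>dist y v\<close> from another point \<open>y\<close> to \<open>v\<close>
  consists of points on geodesics from \<open>y\<close> to \<open>v\<close>, and a geodesic through \<open>x\<close> would make \<open>y\<close>
  farther from \<open>v\<close> than \<open>x\<close>. So everything else stays connected to \<open>v\<close> when \<open>x\<close> is removed.
\<close>

lemma (in realized_tree) connected_without_farthest:
  assumes far: "\<And>y. y \<in> T \<Longrightarrow> dist y v \<le> dist x v" and v: "v \<in> T" "x \<noteq> v"
  shows "connected (T - {x})"
proof -
  have "connected_component (T - {x}) y v"
    if "broken_path same_edge y v L" "L = dist y v" "y \<in> T" "y \<noteq> x" for y L
    using that v far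
  proof (induction rule: broken_path.induct)
    case (refl y)
    then show ?case by simp
  next
    case (step y y' v L)
    have L: "dist y' v \<le> L" using dist_le_broken_path step(2) .
    then have L': "L = dist y' v" and yy': "dist y v = dist y y' + dist y' v"
      using step.prems(1) dist_triangle[of y v y'] by linarith+
    \<comment> \<open>Points between \<open>y\<close> and \<open>y'\<close> also lie between \<open>y\<close> and \<open>v\<close>.\<close>
    have off: "z \<noteq> x" if z: "dist y z + dist z y' = dist y y'" for z
    proof
      assume "z = x"
      then have "dist y x + dist x v \<le> dist y v"
        using z yy' dist_triangle[of x v y'] by simp
      then have "dist x v < dist y v" using step.prems(3) zero_less_dist_iff[of y x] by linarith
      then show False using step.prems(6)[OF step.prems(2)] by simp
    qed
    obtain e where e: "e \<in> E" "y \<in> \<sigma> e" "y' \<in> \<sigma> e" using step(1) by blast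
    obtain a b where ab: "e = {a, b}" "{a, b} \<in> E" using edge_cases[OF e(1)] by metis
    obtain g where "g 0 = a" "g (len e) = b"
      and g: "g ` {0..len e} = \<sigma> e" "isometric_on_segment g (len e)"
      using edge_parametrization[OF ab(2)] unfolding ab(1) .
    obtain s where s: "0 \<le> s" "s \<le> len e" "y = g s" using e(2) g(1) by force
    obtain t where t: "0 \<le> t" "t \<le> len e" "y' = g t" using e(3) g(1) by force
    let ?I = "{min s t..max s t}"
    have sub: "g ` ?I \<subseteq> T - {x}"
    proof
      fix z assume "z \<in> g ` ?I"
      then obtain r where r: "min s t \<le> r" "r \<le> max s t" "z = g r" by auto
      have r': "0 \<le> r" "r \<le> len e" using r(1,2) s(1,2) t(1,2) by linarith+
      have "dist (g s) (g r) + dist (g r) (g t) = dist (g s) (g t)"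
        using isometric_on_segmentD[OF g(2) s(1,2) r'] isometric_on_segmentD[OF g(2) r' t(1,2)]
          isometric_on_segmentD[OF g(2) s(1,2) t(1,2)] r(1,2) by auto
      then have "z \<noteq> x" using off[of z] s(3) t(3) r(3) by simp
      moreover have "z \<in> T" using g(1) r(3) r' edge_subset_T[OF e(1)] by auto
      ultimately show "z \<in> T - {x}" by blast
    qed
    have "connected (g ` ?I)" by (rule isometric_on_segment_image(1)[OF g(2)]) (use s t in auto)
    moreover have ends: "y \<in> g ` ?I" "y' \<in> g ` ?I" using s(3) t(3) by auto
    ultimately have yy: "connected_component (T - {x}) y y'"
      using sub unfolding connected_component_def by blast
    have "y' \<in> T" "y' \<noteq> x" using subsetD[OF sub ends(2)] by auto
    then have "connected_component (T - {x}) y' v" using step.IH L' step.prems(4-6) by blast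
    then show ?case using yy connected_component_trans by blast
  qed
  then have *: "connected_component (T - {x}) y v" if "y \<in> T" "y \<noteq> x" for y
    using that path_metric[OF that(1) v(1)] by blast
  show ?thesis
    unfolding connected_iff_connected_component
  proof (intro ballI)
    fix y z assume "y \<in> T - {x}" "z \<in> T - {x}"
    then show "connected_component (T - {x}) y z"
      using *[of y] connected_component_sym[OF *[of z]] connected_component_trans by blast
  qed
qed

lemma ex_removable_point:
  assumes tree: "finite_metric_tree S" and nt: "nontrivial_tree S" and v: "v \<in> S"
  shows "\<exists>x\<in>S. x \<noteq> v \<and> connected (S - {x})"
proof -
  obtain V E len \<sigma> where "realized_tree V E len \<sigma> S" using tree by (rule finite_metric_treeE)
  then interpret realized_tree V E len \<sigma> S .
  have "continuous_on S (\<lambda>y. dist y v)" by (intro continuous_intros)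
  then obtain x where x: "x \<in> S" "\<And>y. y \<in> S \<Longrightarrow> dist y v \<le> dist x v"
    using continuous_attains_sup[OF T_compact, of "\<lambda>y. dist y v"] v by blast
  have "S \<noteq> {v}" using nt unfolding nontrivial_tree_def by blast
  then obtain y where "y \<in> S" "y \<noteq> v" using v by blast
  then have "x \<noteq> v" using x(2)[of y] by auto
  then show ?thesis using connected_without_farthest[OF x(2) v] x(1) by blast
qed

text \<open>
  A leaf \<open>y\<close> of \<open>X \<union> Y\<close> is not \<open>v\<close>, which cuts \<open>X \<union> Y\<close>; so \<open>Z\<close> is attached away from \<open>y\<close>, and \<open>y\<close>
  remains a leaf of the whole. The end of \<open>Z\<close> farthest from \<open>v\<close> is one more.
\<close>

lemma card_leaves_two_of_three_less:
  assumes tree: "finite_metric_tree (X \<union> Y \<union> Z)"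
    and cl: "closed X" "closed Y" "closed Z"
    and int: "X \<inter> Y = {v}" "X \<inter> Z = {v}" "Y \<inter> Z = {v}"
    and nt: "nontrivial_tree X" "nontrivial_tree Y" "nontrivial_tree Z"
  shows "card (leaves (X \<union> Y)) < card (leaves (X \<union> Y \<union> Z))"
proof -
  let ?U = "X \<union> Y" and ?T = "X \<union> Y \<union> Z"
  have UZ: "?U \<inter> Z = {v}" using int by blast
  have cU: "closed ?U" using cl by blast
  note trees = cut_at_point(1,2)[OF tree HOL.refl cU cl(3) UZ]
  have conn: "connected ?U" "connected Z" using trees finite_metric_tree_connected by auto
  have vU: "v \<in> ?U" "v \<in> Z" using UZ by auto
  have v: "v \<notin> leaves ?U"
    using nt(1,2) by (intro cut_point_not_leaf[OF cl(1,2) int(1)]) (auto simp: nontrivial_tree_def)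
  have "leaves ?U \<subseteq> leaves ?T"
  proof
    fix y assume y: "y \<in> leaves ?U"
    then have yU: "y \<in> ?U" "connected (?U - {y})" by (auto simp: leaves_iff)
    have yv: "y \<noteq> v" using y v by blast
    then have "y \<notin> Z" using yU UZ by blast
    then have "?T - {y} = (?U - {y}) \<union> Z" by blast
    moreover have "connected ((?U - {y}) \<union> Z)"
      using yU(2) conn(2) vU yv by (intro connected_Un) auto
    ultimately show "y \<in> leaves ?T" using yU(1) vU(2) by (auto simp: leaves_iff)
  qed
  moreover obtain x where x: "x \<in> Z" "x \<noteq> v" "connected (Z - {x})"
    using ex_removable_point[OF trees(2) nt(3) vU(2)] by blast
  have xU: "x \<notin> ?U" using x UZ by blast
  then have "?T - {x} = ?U \<union> (Z - {x})" by blast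
  moreover have "connected (?U \<union> (Z - {x}))"
    by (rule connected_Un[OF conn(1) x(3)]) (use x(2) vU in blast)
  ultimately have "x \<in> leaves ?T" using x(1) vU(1) by (auto simp: leaves_iff)
  moreover have "x \<notin> leaves ?U" using xU by (simp add: leaves_iff)
  ultimately have "leaves ?U \<subset> leaves ?T" using \<open>leaves ?U \<subseteq> leaves ?T\<close> by blast
  then show ?thesis using finite_leaves[OF tree] psubset_card_mono by blast
qed

section \<open>Optimal splits\<close>

lemma metric_subtree_closed:
  assumes "finite_metric_tree T" and "metric_subtree S T"
  shows "closed S"
  using assms finite_metric_tree_compact[THEN compact_imp_closed]
  unfolding metric_subtree_def by (meson closedin_closed_trans)

lemma metric_subtreeI:
  assumes "closed S" and "S \<subseteq> T" and "S \<noteq> {}" and "finite_metric_tree S"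
  shows "metric_subtree S T"
  unfolding metric_subtree_def
  using assms(3) closed_subset[OF assms(2,1)] finite_metric_tree_connected[OF assms(4)] by simp

lemma tree_length_segment:
  assumes iso: "isometric_on_segment g t" and t: "0 < t"
  shows "tree_length (g ` {0..t}) = t"
proof -
  define u w S where "u = g 0" and "w = g t" and "S = g ` {0..t}"
  have uw: "u \<noteq> w"
    using inj_onD[OF isometric_on_segment_inj[OF iso], of 0 t] t by (auto simp: u_def w_def)
  have arc: "geodesic_arc u w t S"
    unfolding geodesic_arc_iff u_def w_def S_def using iso by blast
  have ends: "u \<in> S" "w \<in> S" using t by (auto simp: u_def w_def S_def)
  have "(u, w) \<in> adj {{u, w}}" "(w, u) \<in> adj {{u, w}}" by (auto simp: adj_iff)
  then have conn: "\<forall>x\<in>{u, w}. \<forall>y\<in>{u, w}. (x, y) \<in> (adj {{u, w}})\<^sup>*" by auto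
  have bridges: "(x, y) \<notin> (adj ({{u, w}} - {{x, y}}))\<^sup>*" if "{x, y} \<in> {{u, w}}" for x y
  proof -
    have "adj ({{u, w}} - {{x, y}}) = {}" using that by (auto simp: adj_def)
    moreover have "x \<noteq> y" using that uw by (auto simp: doubleton_eq_iff)
    ultimately show ?thesis by simp
  qed
  have "realized_tree {u, w} {{u, w}} (\<lambda>_. t) (\<lambda>_. S) S"
  proof
    show "combinatorial_tree {u, w} {{u, w}}"
      unfolding combinatorial_tree_iff_bridges using conn bridges uw by auto
  next
    fix a b assume "{a, b} \<in> {{u, w}}"
    then have "(a = u \<and> b = w) \<or> (a = w \<and> b = u)" by (auto simp: doubleton_eq_iff)
    then show "geodesic_arc a b t S" using arc geodesic_arc_commute by blast
  next
    fix x y assume "x \<in> S" "y \<in> S"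
    then show "broken_path (\<lambda>a b. \<exists>e\<in>{{u, w}}. a \<in> S \<and> b \<in> S) x y (dist x y)"
      by (intro broken_path_single) simp
  qed (use t ends in auto)
  then show ?thesis using realized_tree.tree_length_eq by (fastforce simp: S_def)
qed

lemma split_length_le:
  assumes tree: "finite_metric_tree T" and T: "T = C \<union> D" and cl: "closed C" "closed D"
    and CD: "C \<inter> D = {p}"
  shows "split_length T \<le> max (tree_length C) (tree_length D)"
proof -
  note cut = cut_at_point[OF tree T cl CD]
  have "metric_subtree C T" "metric_subtree D T"
    using cl cut T CD by (auto intro!: metric_subtreeI)
  then have "two_piece_decomposition T C D"
    unfolding two_piece_decomposition_def using T cut(3) CD by blast
  moreover have "bdd_below {max (tree_length C) (tree_length D) | C D. two_piece_decomposition T C D}"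
  proof (rule bdd_belowI)
    fix m assume "m \<in> {max (tree_length C) (tree_length D) | C D. two_piece_decomposition T C D}"
    then obtain C D where m: "m = max (tree_length C) (tree_length D)"
        and "two_piece_decomposition T C D"
      by blast
    then have "tree_length T = tree_length C + tree_length D"
      unfolding two_piece_decomposition_def by (elim conjE)
    \<comment> \<open>The longer piece has at least half of the total length.\<close>
    then show "tree_length T / 2 \<le> m" unfolding m by linarith
  qed
  ultimately show ?thesis
    unfolding split_length_def by (intro cInf_lower) auto
qed

text \<open>
  If only one edge left \<open>v\<close> into the longer piece, a short segment of it could be moved to the
  shorter piece, which would lower the maximum.
\<close>

lemma optimal_split_longer_piece_branches:
  assumes tree: "finite_metric_tree T" and T: "T = A \<union> B" and cl: "closed A" "closed B"
    and AB: "A \<inter> B = {v}"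
    and opt: "tree_length A = split_length T" and less: "tree_length B < tree_length A"
    and nt: "nontrivial_tree A"
  obtains P R where "A = P \<union> R" "P \<inter> R = {v}" "closed P" "closed R"
    "nontrivial_tree P" "nontrivial_tree R"
proof -
  note cut = cut_at_point[OF tree T cl AB]
  have "v \<in> A" using AB by blast
  with cut(1) nt obtain P Q g l where br: "bridge_arc A P Q g l" and g0: "g 0 = v"
    by (rule ex_bridge_arc_at)
  have l: "0 < l" and iso: "isometric_on_segment g l" and P: "P \<inter> g ` {0..l} = {g 0}"
    using br by (auto simp: bridge_arc_def)
  define R where "R = g ` {0..l} \<union> Q"
  have v0: "P \<union> g ` {0..0} = P" using P by auto
  note cut0 = bridge_arc_cut[OF br order_refl less_imp_le[OF l], unfolded v0 g0, folded R_def]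
  have ends: "g 0 \<noteq> g l" "g 0 \<in> R" "g l \<in> R"
    using inj_onD[OF isometric_on_segment_inj[OF iso], of 0 l] l by (force simp: R_def)+
  then have R: "nontrivial_tree R" unfolding nontrivial_tree_def by fastforce
  have "nontrivial_tree P"
  proof (rule ccontr)
    assume "\<not> nontrivial_tree P"
    then obtain x where "P = {x}" unfolding nontrivial_tree_def by blast
    moreover have "v \<in> P" using cut0(2) by blast
    ultimately have Pv: "P = {v}" by simp
    obtain t where "0 < t" "t < l" "t < tree_length A - tree_length B"
      using field_lbound_gt_zero[of l "tree_length A - tree_length B"] l less by auto
    then have t: "0 < t" "t \<le> l" "t < tree_length A - tree_length B" by simp_all
    \<comment> \<open>The competing split is \<open>Y\<close> and \<open>B \<union> X\<close>, where \<open>X\<close> is the moved segment.\<close>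
    define X where "X = P \<union> g ` {0..t}"
    define Y where "Y = g ` {t..l} \<union> Q"
    note cutt = bridge_arc_cut[OF br less_imp_le[OF t(1)] t(2), folded X_def Y_def]
    have X: "X = g ` {0..t}" using Pv g0 t(1) by (force simp: X_def)
    have iso_t: "isometric_on_segment g t" using iso t(2) by (auto simp: isometric_on_segment_def)
    have Y_len: "tree_length A = t + tree_length Y"
      using cut_at_point(3)[OF cut(1) cutt(1,3,4,2)] tree_length_segment[OF iso_t t(1)] X by simp
    have "v \<noteq> g t"
      using inj_onD[OF isometric_on_segment_inj[OF iso], of t 0] t g0 by auto
    then have "v \<notin> X \<inter> Y" unfolding cutt(2) by simp
    moreover have "v \<in> X" using Pv X_def by blast
    ultimately have vY: "v \<notin> Y" by blast
    have "Y \<inter> B \<subseteq> A \<inter> B" using cutt(1) by blast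
    then have "Y \<inter> B = {}" using vY AB by auto
    then have Y_BX: "Y \<inter> (B \<union> X) = {g t}" using cutt(2) by (simp add: Int_Un_distrib Int_commute)
    have T': "T = Y \<union> (B \<union> X)" using T cutt(1) by blast
    have cl': "closed (B \<union> X)" using cl(2) cutt(3) by (rule closed_Un)
    have "tree_length T = tree_length Y + tree_length (B \<union> X)"
      using cut_at_point(3)[OF tree T' cutt(4) cl' Y_BX] .
    moreover have "split_length T \<le> max (tree_length Y) (tree_length (B \<union> X))"
      using split_length_le[OF tree T' cutt(4) cl' Y_BX] .
    ultimately show False using cut(3) Y_len opt t by linarith
  qed
  from that[OF cut0 this R] show thesis .
qed


theorem proposition3p10:
  fixes T A B :: "'a::metric_space set" and v :: 'a and lam b :: real
  assumes "finite_metric_tree T" and "nontrivial_tree T"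
    and "optimal_split T A B" and "A \<inter> B = {v}"
    and "lam = split_length T"
    and "tree_length A = lam" and "lam \<ge> b" and "b = tree_length B" and "b > 0"
    and "lam > b"
  shows "\<exists>S :: nat \<Rightarrow> 'a set.
    (\<forall>i\<in>{1..3}. metric_subtree (S i) T \<and> nontrivial_tree (S i) \<and> v \<in> S i) \<and>
    T = S 1 \<union> S 2 \<union> S 3 \<and>
    (\<forall>i\<in>{1..3}. \<forall>j\<in>{1..3}. i \<noteq> j \<longrightarrow> S i \<inter> S j = {v}) \<and>
    (\<forall>i\<in>{1..3}. tree_length (S i) \<le> b) \<and>
    (\<forall>i\<in>{1..3}. \<forall>j\<in>{1..3}. i \<noteq> j \<longrightarrow>
       tree_length (S i \<union> S j) \<ge> lam \<and>
       card (leaves (S i \<union> S j)) < card (leaves T))"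
proof -
  note tree = assms(1) and AB = assms(4)
  have dec: "metric_subtree A T" "metric_subtree B T" "T = A \<union> B"
    using assms(3) by (auto simp: optimal_split_def two_piece_decomposition_def)
  have cl: "closed A" "closed B" using dec(1,2) metric_subtree_closed[OF tree] by auto
  note cut = cut_at_point[OF tree dec(3) cl AB]
  have nt: "nontrivial_tree A" "nontrivial_tree B"
    using tree_length_pos_iff cut(1,2) assms(6,8,9,10) by force+
  obtain P R where PR: "A = P \<union> R" "P \<inter> R = {v}" "closed P" "closed R"
      "nontrivial_tree P" "nontrivial_tree R"
    using optimal_split_longer_piece_branches[OF tree dec(3) cl AB _ _ nt(1)] assms(5,6,8,10)
    by metis
  note cutA = cut_at_point[OF cut(1) PR(1,3,4,2)]
  have pos: "0 < tree_length P" "0 < tree_length R"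
    using tree_length_pos_iff cutA(1,2) PR(5,6) by auto
  have int: "P \<inter> R = {v}" "P \<inter> B = {v}" "R \<inter> B = {v}" using PR(1,2) AB by blast+
  have T: "T = P \<union> R \<union> B" using dec(3) PR(1) by simp
  have T_P: "T = P \<union> (R \<union> B)" and T_R: "T = R \<union> (P \<union> B)" using T by auto
  have int_P: "P \<inter> (R \<union> B) = {v}" and int_R: "R \<inter> (P \<union> B) = {v}" using int by auto
  have cl_RB: "closed (R \<union> B)" and cl_PB: "closed (P \<union> B)" using PR cl by auto
  have len_T: "tree_length T = tree_length P + tree_length (R \<union> B)"
      "tree_length T = tree_length R + tree_length (P \<union> B)"
    using cut_at_point(3)[OF tree T_P PR(3) cl_RB int_P]
      cut_at_point(3)[OF tree T_R PR(4) cl_PB int_R] by auto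
  have "lam \<le> max (tree_length P) (tree_length (R \<union> B))"
      "lam \<le> max (tree_length R) (tree_length (P \<union> B))"
    using split_length_le[OF tree T_P PR(3) cl_RB int_P]
      split_length_le[OF tree T_R PR(4) cl_PB int_R] assms(5) by auto
  then have len_RB: "lam \<le> tree_length (R \<union> B)" and len_PB: "lam \<le> tree_length (P \<union> B)"
    using cutA(3) pos assms(6) by auto
  have le_b: "tree_length P \<le> b" "tree_length R \<le> b"
    using len_RB len_PB len_T cut(3) assms(6,8) by linarith+
  have len_PR: "lam \<le> tree_length (P \<union> R)" using PR(1) assms(6) by simp
  have subtrees: "metric_subtree P T" "metric_subtree R T" "metric_subtree B T"
  proof -
    have "P \<subseteq> T" "R \<subseteq> T" "P \<noteq> {}" "R \<noteq> {}" using T int by blast+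
    then show "metric_subtree P T" "metric_subtree R T"
      using metric_subtreeI[OF PR(3) _ _ cutA(1)] metric_subtreeI[OF PR(4) _ _ cutA(2)] by simp_all
  qed (rule dec(2))
  have T': "T = P \<union> B \<union> R" "T = R \<union> B \<union> P" using T by (simp_all add: Un_ac)
  have int': "R \<inter> P = {v}" "B \<inter> P = {v}" "B \<inter> R = {v}" using int by (simp_all add: Int_commute)
  note fewer = card_leaves_two_of_three_less
  have leaves: "card (leaves (P \<union> R)) < card (leaves T)" "card (leaves (P \<union> B)) < card (leaves T)"
      "card (leaves (R \<union> B)) < card (leaves T)"
    using fewer[OF tree[unfolded T] PR(3,4) cl(2) int PR(5,6) nt(2)]
      fewer[OF tree[unfolded T'(1)] PR(3) cl(2) PR(4) int(2,1) int'(3) PR(5) nt(2) PR(6)]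
      fewer[OF tree[unfolded T'(2)] PR(4) cl(2) PR(3) int(3) int'(1,2) PR(6) nt(2) PR(5)]
    unfolding T[symmetric] T'[symmetric] .
  define S :: "nat \<Rightarrow> 'a set" where "S = (\<lambda>i. if i = 1 then P else if i = 2 then R else B)"
  have S: "S 1 = P" "S 2 = R" "S 3 = B" by (simp_all add: S_def)
  have range: "{1..3} = {1, 2, 3 :: nat}" by auto
  have v: "v \<in> P" "v \<in> R" "v \<in> B" using int by auto
  have S1: "\<forall>i\<in>{1..3}. metric_subtree (S i) T \<and> nontrivial_tree (S i) \<and> v \<in> S i"
    unfolding range using subtrees PR(5,6) nt(2) v S by simp
  have S2: "\<forall>i\<in>{1..3}. \<forall>j\<in>{1..3}. i \<noteq> j \<longrightarrow> S i \<inter> S j = {v}"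
    unfolding range using int S by (simp add: Int_commute)
  have S3: "\<forall>i\<in>{1..3}. tree_length (S i) \<le> b"
    unfolding range using le_b assms(8) S by simp
  have S4: "\<forall>i\<in>{1..3}. \<forall>j\<in>{1..3}. i \<noteq> j \<longrightarrow>
       tree_length (S i \<union> S j) \<ge> lam \<and> card (leaves (S i \<union> S j)) < card (leaves T)"
    unfolding range using len_PR len_PB len_RB leaves S by (simp add: Un_commute)
  have "T = S 1 \<union> S 2 \<union> S 3" using T S by simp
  with S1 S2 S3 S4 show ?thesis by blast
qed

end
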